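(* Let $\mathbb{D}$ be the Fraïssé limit of the class $\mathcal{D}$ of finite $L$-structures $A$ such that $(\mathrm{dom}(A), R^A)$ is an $I_3$-free oriented graph and $(\mathrm{dom}(A), S^A)$ is a semifinal structure. Then $\mathbb{D}$ has a universal automorphism group: for each structure $A$ embeddable in $\mathbb{D}$ (finite or infinite), there is an injective group homomorphism $\mathrm{Aut}(A) \to \mathrm{Aut}(\mathbb{D})$.
   Context: $L = \{R, S\}$ with $R$ a binary and $S$ a $4$-ary relation symbol. $(V,R)$ is an $I_3$-free oriented graph if $R$ is irreflexive and asymmetric and every $3$-element subset of $V$ contains two vertices $u,v$ with $R(u,v)$. $(V,S)$ is a semifinal structure if every tuple in $S$ consists of four distinct elements and, for each $B \subseteq V$ with $|B|=4$, there is an enumeration $b_0,b_1,b_2,b_3$ of $B$ such that $S \cap B^4 = \{(b_0,b_1,b_2,b_3),(b_2,b_3,b_0,b_1)\}$. The class $\mathcal{D}$ has strong amalgamation, and $\mathbb{D}$ denotes its Fraïssé limit: the countable ultrahomogeneous structure (each isomorphism between finite substructures extends to an automorphism), unique up to isomorphism, whose finite substructures are up to isomorphism exactly the members of $\mathcal{D}$. *)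

theory Defs
  imports "HOL-Algebra.Bij" "HOL-Library.Countable_Set"
begin

record 'a lstr = "'a partial_object" +
  relR :: "('a \<times> 'a) set"
  relS :: "('a \<times> 'a \<times> 'a \<times> 'a) set"

definition lstructure :: "'a lstr \<Rightarrow> bool" where
  "lstructure A \<longleftrightarrow>
     relR A \<subseteq> carrier A \<times> carrier A \<and>
     relS A \<subseteq> carrier A \<times> carrier A \<times> carrier A \<times> carrier A"

definition substr :: "'a lstr \<Rightarrow> 'a set \<Rightarrow> 'a lstr" where
  "substr A X = \<lparr>carrier = X,
     relR = relR A \<inter> X \<times> X,
     relS = relS A \<inter> X \<times> X \<times> X \<times> X\<rparr>"

definition embedding :: "'a lstr \<Rightarrow> 'b lstr \<Rightarrow> ('a \<Rightarrow> 'b) \<Rightarrow> bool" where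
  "embedding A B f \<longleftrightarrow>
     f ` carrier A \<subseteq> carrier B \<and> inj_on f (carrier A) \<and>
     (\<forall>x\<in>carrier A. \<forall>y\<in>carrier A. (x, y) \<in> relR A \<longleftrightarrow> (f x, f y) \<in> relR B) \<and>
     (\<forall>x\<in>carrier A. \<forall>y\<in>carrier A. \<forall>z\<in>carrier A. \<forall>w\<in>carrier A.
        (x, y, z, w) \<in> relS A \<longleftrightarrow> (f x, f y, f z, f w) \<in> relS B)"

definition isomorphism :: "'a lstr \<Rightarrow> 'b lstr \<Rightarrow> ('a \<Rightarrow> 'b) \<Rightarrow> bool" where
  "isomorphism A B f \<longleftrightarrow> embedding A B f \<and> f ` carrier A = carrier B"

definition embeddable :: "'a lstr \<Rightarrow> 'b lstr \<Rightarrow> bool" where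
  "embeddable A B \<longleftrightarrow> (\<exists>f. embedding A B f)"

definition isomorphic :: "'a lstr \<Rightarrow> 'b lstr \<Rightarrow> bool" where
  "isomorphic A B \<longleftrightarrow> (\<exists>f. isomorphism A B f)"

(* As for AutoGroup: elements of Bij are extensional, so an automorphism is
   determined by its values on the carrier. *)
definition Aut :: "'a lstr \<Rightarrow> ('a \<Rightarrow> 'a) monoid" where
  "Aut A = BijGroup (carrier A) \<lparr>carrier := {f \<in> Bij (carrier A). isomorphism A A f}\<rparr>"

definition I3_free_oriented_graph :: "'a set \<Rightarrow> ('a \<times> 'a) set \<Rightarrow> bool" where
  "I3_free_oriented_graph V E \<longleftrightarrow>
     E \<subseteq> V \<times> V \<and> irrefl E \<and> asym E \<and>
     (\<forall>B. B \<subseteq> V \<and> card B = 3 \<longrightarrow> (\<exists>u\<in>B. \<exists>v\<in>B. (u, v) \<in> E))"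

definition semifinal :: "'a set \<Rightarrow> ('a \<times> 'a \<times> 'a \<times> 'a) set \<Rightarrow> bool" where
  "semifinal V T \<longleftrightarrow>
     T \<subseteq> V \<times> V \<times> V \<times> V \<and>
     (\<forall>a b c d. (a, b, c, d) \<in> T \<longrightarrow> distinct [a, b, c, d]) \<and>
     (\<forall>B. B \<subseteq> V \<and> card B = 4 \<longrightarrow>
        (\<exists>b0 b1 b2 b3. B = {b0, b1, b2, b3} \<and>
           T \<inter> B \<times> B \<times> B \<times> B = {(b0, b1, b2, b3), (b2, b3, b0, b1)}))"

(* Finite structures are taken with domain in nat, which loses none of them up to isomorphism. *)
definition class_D :: "nat lstr set" where
  "class_D = {A. finite (carrier A) \<and>
     I3_free_oriented_graph (carrier A) (relR A) \<and> semifinal (carrier A) (relS A)}"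

definition ultrahomogeneous :: "'a lstr \<Rightarrow> bool" where
  "ultrahomogeneous M \<longleftrightarrow>
     (\<forall>X Y f. X \<subseteq> carrier M \<and> finite X \<and> Y \<subseteq> carrier M \<and> finite Y \<and>
        isomorphism (substr M X) (substr M Y) f \<longrightarrow>
        (\<exists>g \<in> carrier (Aut M). \<forall>x\<in>X. g x = f x))"

definition fraisse_limit :: "nat lstr set \<Rightarrow> 'a lstr \<Rightarrow> bool" where
  "fraisse_limit K M \<longleftrightarrow>
     lstructure M \<and> countable (carrier M) \<and> ultrahomogeneous M \<and>
     (\<forall>X. X \<subseteq> carrier M \<and> finite X \<longrightarrow> (\<exists>A\<in>K. isomorphic (substr M X) A)) \<and>
     (\<forall>A\<in>K. \<exists>X. X \<subseteq> carrier M \<and> finite X \<and> isomorphic A (substr M X))"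

end

theory Submission
  imports Defs
begin

text \<open>
  An automorphism of \<open>A\<close> need not extend to the limit along an embedding of \<open>A\<close>: an involution
  fixing a point \<open>a\<close> cannot be extended to a new point not adjacent to \<open>a\<close>. So \<open>Aut A\<close> is made to
  act on another structure. The axioms on \<open>S\<close> force the setwise stabiliser of a four-element subset of \<open>A\<close> to act
  on it as the identity or as one fixed-point-free involution. Hence in the action on injective
  4-tuples of \<open>A\<close>, an element fixing a tuple has no orbits of length two or three, and stabilisers of
  four-element sets act freely with order at most two; moreover no three tuples are pairwise exchanged, because
  exchanged points of \<open>A\<close> are not adjacent.

  Starting from these tuples, freely adjoin points that carry a base tuple, a finite list of
  earlier points, and a prescription of their relations to these points. Relations that are not
  prescribed are chosen invariantly: a pair is left without an edge exactly if some
  automorphism exchanges it, and each remaining four-element set gets an enumeration compatible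
  with its stabiliser. The resulting countable structure belongs locally to the class, has the
  extension property by construction, and so is the limit by back-and-forth; \<open>Aut A\<close> acts on it
  faithfully.
\<close>

section \<open>Structures of the class and back-and-forth\<close>

text \<open>Points of \<open>A\<close> alone would not do: an involution of \<open>A\<close> may fix
  one point while moving others. It cannot fix two, so fixing a tuple with at least two entries
  excludes it. The length four comes from a count: two distinct tuples exchanged by an automorphism
  agree in at most one coordinate, so three pairwise exchanged tuples would leave one of four
  coordinates without any agreement, and there \<open>A\<close> would have three distinct, pairwise
  nonadjacent points. Every adjoined point carries a base tuple because the base commutes with the
  action. An element fixing the point fixes its base, and exchanged points have different bases, so
  the configurations forbidden for tuples are forbidden for all points. That the free construction
  creates no three pairwise nonadjacent points rests on comparing sizes: exchanged points have equal
  size, whereas a point is larger than every point on its list.\<close>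

definition D_structure :: "'a lstr \<Rightarrow> bool" where
  "D_structure N \<longleftrightarrow>
     I3_free_oriented_graph (carrier N) (relR N) \<and> semifinal (carrier N) (relS N)"

lemma substr_simps [simp]:
  "carrier (substr N X) = X"
  "relR (substr N X) = relR N \<inter> X \<times> X"
  "relS (substr N X) = relS N \<inter> X \<times> X \<times> X \<times> X"
  by (simp_all add: substr_def)

lemma lstructure_substr [simp]: "lstructure (substr N X)"
  by (auto simp: lstructure_def)

lemma embedding_substr_id:
  "X \<subseteq> carrier N \<Longrightarrow> embedding (substr N X) N (\<lambda>x. x)"
  by (auto simp: embedding_def)

lemma embedding_comp:
  assumes "embedding N N' f" "embedding N' N'' g"
  shows "embedding N N'' (g \<circ> f)"
  unfolding embedding_def
proof (intro conjI)
  have "f ` carrier N \<subseteq> carrier N'" "inj_on f (carrier N)" "inj_on g (carrier N')"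
    using assms by (simp_all add: embedding_def)
  then show "inj_on (g \<circ> f) (carrier N)" by (meson comp_inj_on inj_on_subset)
qed (use assms in \<open>simp_all add: embedding_def image_subset_iff\<close>)

text \<open>The witnesses that the axioms ask for lie in the given three- or four-element set
  itself, so they pull back along an injective map that preserves and reflects the
  relations.\<close>

lemma D_structure_embedding:
  assumes N: "lstructure N" and e: "embedding N N' f" and D: "D_structure N'"
  shows "D_structure N"
proof -
  have fV: "\<And>x. x \<in> carrier N \<Longrightarrow> f x \<in> carrier N'" and inj: "inj_on f (carrier N)"
    and R: "\<And>x y. x \<in> carrier N \<Longrightarrow> y \<in> carrier N \<Longrightarrow> (x, y) \<in> relR N \<longleftrightarrow> (f x, f y) \<in> relR N'"
    and S: "\<And>x y z w. x \<in> carrier N \<Longrightarrow> y \<in> carrier N \<Longrightarrow> z \<in> carrier N \<Longrightarrow> w \<in> carrier N \<Longrightarrow>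
      (x, y, z, w) \<in> relS N \<longleftrightarrow> (f x, f y, f z, f w) \<in> relS N'"
    using e by (auto simp: embedding_def)
  have RV: "relR N \<subseteq> carrier N \<times> carrier N"
    and SV: "relS N \<subseteq> carrier N \<times> carrier N \<times> carrier N \<times> carrier N"
    using N by (auto simp: lstructure_def)
  have irr: "irrefl (relR N')" and asy: "asym (relR N')"
    and i3: "\<And>B. B \<subseteq> carrier N' \<Longrightarrow> card B = 3 \<Longrightarrow> \<exists>u\<in>B. \<exists>v\<in>B. (u, v) \<in> relR N'"
    and dis: "\<And>a b c d. (a, b, c, d) \<in> relS N' \<Longrightarrow> distinct [a, b, c, d]"
    and s4: "\<And>B. B \<subseteq> carrier N' \<Longrightarrow> card B = 4 \<Longrightarrow>
        \<exists>b0 b1 b2 b3. B = {b0, b1, b2, b3} \<and>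
           relS N' \<inter> B \<times> B \<times> B \<times> B = {(b0, b1, b2, b3), (b2, b3, b0, b1)}"
    using D by (simp_all add: D_structure_def I3_free_oriented_graph_def semifinal_def)
  have "I3_free_oriented_graph (carrier N) (relR N)"
    unfolding I3_free_oriented_graph_def
  proof (intro conjI allI impI)
    show "relR N \<subseteq> carrier N \<times> carrier N" by (rule RV)
    show "irrefl (relR N)"
      using irr R RV by (auto simp: irrefl_def)
    show "asym (relR N)"
      using asy R RV by (auto simp: asym_iff)
  next
    fix B assume B: "B \<subseteq> carrier N \<and> card B = 3"
    then have "card (f ` B) = 3" using inj by (metis card_image inj_on_subset)
    moreover have "f ` B \<subseteq> carrier N'" using B fV by auto
    ultimately obtain u v where "u \<in> B" "v \<in> B" "(f u, f v) \<in> relR N'" using i3[of "f ` B"] by auto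
    then show "\<exists>u\<in>B. \<exists>v\<in>B. (u, v) \<in> relR N" using R[of u v] B by blast
  qed
  moreover have "semifinal (carrier N) (relS N)"
    unfolding semifinal_def
  proof (intro conjI allI impI)
    show "relS N \<subseteq> carrier N \<times> carrier N \<times> carrier N \<times> carrier N" by (rule SV)
  next
    fix a b c d assume *: "(a, b, c, d) \<in> relS N"
    then have "distinct [f a, f b, f c, f d]" using dis S SV by blast
    then show "distinct [a, b, c, d]" by auto
  next
    fix B assume B: "B \<subseteq> carrier N \<and> card B = 4"
    then have "card (f ` B) = 4" using inj by (metis card_image inj_on_subset)
    moreover have "f ` B \<subseteq> carrier N'" using B fV by auto
    ultimately obtain b0 b1 b2 b3 where *: "f ` B = {b0, b1, b2, b3}"
      "relS N' \<inter> f ` B \<times> f ` B \<times> f ` B \<times> f ` B = {(b0, b1, b2, b3), (b2, b3, b0, b1)}"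
      using s4[of "f ` B"] by auto
    then have "b0 \<in> f ` B" "b1 \<in> f ` B" "b2 \<in> f ` B" "b3 \<in> f ` B" by simp_all
    then obtain a0 a1 a2 a3 where a: "a0 \<in> B" "a1 \<in> B" "a2 \<in> B" "a3 \<in> B"
      "b0 = f a0" "b1 = f a1" "b2 = f a2" "b3 = f a3"
      by (elim imageE) blast
    have iB: "inj_on f B" using inj B inj_on_subset by blast
    then have Beq: "B = {a0, a1, a2, a3}"
      using inj_on_image_eq_iff[OF iB, of B "{a0, a1, a2, a3}"] *(1) a by simp
    have eq: "(x, y, z, w) \<in> relS N \<longleftrightarrow> (x, y, z, w) \<in> {(a0, a1, a2, a3), (a2, a3, a0, a1)}"
      if "x \<in> B" "y \<in> B" "z \<in> B" "w \<in> B" for x y z w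
    proof -
      have "(x, y, z, w) \<in> relS N \<longleftrightarrow> (f x, f y, f z, f w) \<in> relS N' \<inter> f ` B \<times> f ` B \<times> f ` B \<times> f ` B"
        using that S B by (auto simp: subset_iff)
      also have "\<dots> \<longleftrightarrow> (f x, f y, f z, f w) \<in> {(f a0, f a1, f a2, f a3), (f a2, f a3, f a0, f a1)}"
        unfolding *(2) a(5-8) ..
      also have "\<dots> \<longleftrightarrow> (x, y, z, w) \<in> {(a0, a1, a2, a3), (a2, a3, a0, a1)}"
        using that a iB by (simp add: inj_on_eq_iff)
      finally show ?thesis .
    qed
    have "relS N \<inter> B \<times> B \<times> B \<times> B = {(a0, a1, a2, a3), (a2, a3, a0, a1)}"
    proof (intro equalityI subsetI)
      fix t assume "t \<in> relS N \<inter> B \<times> B \<times> B \<times> B"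
      then show "t \<in> {(a0, a1, a2, a3), (a2, a3, a0, a1)}"
        by (cases t) (metis IntE SigmaD1 SigmaD2 eq)
    next
      fix t assume "t \<in> {(a0, a1, a2, a3), (a2, a3, a0, a1)}"
      then show "t \<in> relS N \<inter> B \<times> B \<times> B \<times> B"
        using eq[OF a(1-4)] eq[OF a(3,4,1,2)] a(1-4) by (elim insertE emptyE) simp_all
    qed
    with Beq show "\<exists>b0 b1 b2 b3. B = {b0, b1, b2, b3} \<and>
           relS N \<inter> B \<times> B \<times> B \<times> B = {(b0, b1, b2, b3), (b2, b3, b0, b1)}" by blast
  qed
  ultimately show ?thesis by (simp add: D_structure_def)
qed

text \<open>Each axiom speaks of at most four points. This transfers the axioms from the finite
  substructures of a Fraisse limit to the limit itself.\<close>

lemma D_structure_local: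
  assumes N: "lstructure N"
    and fin: "\<And>X. X \<subseteq> carrier N \<Longrightarrow> finite X \<Longrightarrow> D_structure (substr N X)"
  shows "D_structure N"
proof -
  have I: "I3_free_oriented_graph X (relR N \<inter> X \<times> X)"
    and S: "semifinal X (relS N \<inter> X \<times> X \<times> X \<times> X)" if "X \<subseteq> carrier N" "finite X" for X
    using fin[OF that] by (simp_all add: D_structure_def)
  have RV: "relR N \<subseteq> carrier N \<times> carrier N"
    and SV: "relS N \<subseteq> carrier N \<times> carrier N \<times> carrier N \<times> carrier N"
    using N by (auto simp: lstructure_def)
  have "I3_free_oriented_graph (carrier N) (relR N)"
    unfolding I3_free_oriented_graph_def
  proof (intro conjI allI impI)
    show "relR N \<subseteq> carrier N \<times> carrier N" by (rule RV)
    show "irrefl (relR N)"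
    proof (rule irreflI)
      fix x show "(x, x) \<notin> relR N"
      proof
        assume *: "(x, x) \<in> relR N"
        then have "{x} \<subseteq> carrier N" using RV by auto
        from I[OF this] * show False by (simp add: I3_free_oriented_graph_def irrefl_def)
      qed
    qed
    show "asym (relR N)"
    proof (rule asymI)
      fix x y assume *: "(x, y) \<in> relR N"
      then have "{x, y} \<subseteq> carrier N" using RV by auto
      from I[OF this] * show "(y, x) \<notin> relR N"
        unfolding I3_free_oriented_graph_def asym_iff by blast
    qed
  next
    fix B assume B: "B \<subseteq> carrier N \<and> card B = 3"
    then have "finite B" by (intro card_ge_0_finite) simp
    with I[of B] B show "\<exists>u\<in>B. \<exists>v\<in>B. (u, v) \<in> relR N"
      unfolding I3_free_oriented_graph_def by blast
  qed
  moreover have "semifinal (carrier N) (relS N)"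
    unfolding semifinal_def
  proof (intro conjI allI impI)
    show "relS N \<subseteq> carrier N \<times> carrier N \<times> carrier N \<times> carrier N" by (rule SV)
  next
    fix a b c d assume *: "(a, b, c, d) \<in> relS N"
    then have "{a, b, c, d} \<subseteq> carrier N" using SV by auto
    from S[OF this] * show "distinct [a, b, c, d]" unfolding semifinal_def by blast
  next
    fix B assume B: "B \<subseteq> carrier N \<and> card B = 4"
    then have "finite B" by (intro card_ge_0_finite) simp
    then have "semifinal B (relS N \<inter> B \<times> B \<times> B \<times> B)" using S B by blast
    then have "\<exists>b0 b1 b2 b3. B = {b0, b1, b2, b3} \<and>
        (relS N \<inter> B \<times> B \<times> B \<times> B) \<inter> B \<times> B \<times> B \<times> B = {(b0, b1, b2, b3), (b2, b3, b0, b1)}"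
      unfolding semifinal_def using B by blast
    then show "\<exists>b0 b1 b2 b3. B = {b0, b1, b2, b3} \<and>
           relS N \<inter> B \<times> B \<times> B \<times> B = {(b0, b1, b2, b3), (b2, b3, b0, b1)}"
      by (simp only: Int_assoc Int_absorb)
  qed
  ultimately show ?thesis by (simp add: D_structure_def)
qed

lemma fraisse_limit_D_structure:
  assumes "fraisse_limit class_D M"
  shows "D_structure M"
proof (rule D_structure_local)
  show "lstructure M" using assms by (simp add: fraisse_limit_def)
  fix X assume "X \<subseteq> carrier M" "finite X"
  then obtain A where "A \<in> class_D" "isomorphic (substr M X) A"
    using assms by (auto simp: fraisse_limit_def)
  then show "D_structure (substr M X)"
    by (auto simp: class_D_def isomorphic_def isomorphism_def D_structure_def[of A]
        intro: D_structure_embedding[of _ A])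
qed

text \<open>Finite partial isomorphisms are represented by their graphs, so that the two halves of the
  back-and-forth argument are exchanged by \<^const>\<open>converse\<close>.\<close>

definition partial_iso :: "'a lstr \<Rightarrow> 'b lstr \<Rightarrow> ('a \<times> 'b) set \<Rightarrow> bool" where
  "partial_iso N N' P \<longleftrightarrow> P \<subseteq> carrier N \<times> carrier N' \<and>
     (\<forall>p\<in>P. \<forall>q\<in>P. (fst p = fst q \<longleftrightarrow> snd p = snd q) \<and>
       ((fst p, fst q) \<in> relR N \<longleftrightarrow> (snd p, snd q) \<in> relR N') \<and>
       (\<forall>r\<in>P. \<forall>s\<in>P. (fst p, fst q, fst r, fst s) \<in> relS N \<longleftrightarrow> (snd p, snd q, snd r, snd s) \<in> relS N'))"

lemma partial_iso_swap: "partial_iso N N' P \<Longrightarrow> partial_iso N' N (P\<inverse>)"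
proof -
  have "P\<inverse> = prod.swap ` P" by force
  moreover assume "partial_iso N N' P"
  ultimately show ?thesis by (auto simp: partial_iso_def)
qed

lemma partial_iso_converse: "partial_iso N' N (P\<inverse>) \<longleftrightarrow> partial_iso N N' P"
  using partial_iso_swap[of N N' P] partial_iso_swap[of N' N "P\<inverse>"] by auto

lemma partial_iso_graph:
  assumes "embedding (substr N X) N' f" "X \<subseteq> carrier N"
  shows "partial_iso N N' ((\<lambda>a. (a, f a)) ` X)"
  unfolding partial_iso_def
proof (intro conjI ballI)
  show "(\<lambda>a. (a, f a)) ` X \<subseteq> carrier N \<times> carrier N'"
    using assms by (auto simp: embedding_def)
qed (use assms in \<open>auto simp: embedding_def inj_on_eq_iff\<close>)

lemma partial_iso_function:
  assumes "partial_iso N N' P"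
  obtains f where "P = (\<lambda>a. (a, f a)) ` fst ` P" "embedding (substr N (fst ` P)) N' f"
proof -
  define f where "f a = (SOME a'. (a, a') \<in> P)" for a
  have main: "fst p = fst q \<longleftrightarrow> snd p = snd q" "(fst p, fst q) \<in> relR N \<longleftrightarrow> (snd p, snd q) \<in> relR N'"
    "(fst p, fst q, fst r, fst s) \<in> relS N \<longleftrightarrow> (snd p, snd q, snd r, snd s) \<in> relS N'"
    if "p \<in> P" "q \<in> P" "r \<in> P" "s \<in> P" for p q r s
    using that assms unfolding partial_iso_def by blast+
  have fP: "(fst p, f (fst p)) \<in> P" if "p \<in> P" for p
    unfolding f_def using that by (auto intro: someI[of _ "snd p"])
  then have "(fst p, f (fst p)) = p" if "p \<in> P" for p
    using main(1)[of p "(fst p, f (fst p))"] that by (simp add: prod_eq_iff)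
  then have P: "P = (\<lambda>a. (a, f a)) ` fst ` P"
    using image_cong[OF refl, of P "\<lambda>p. (fst p, f (fst p))" "\<lambda>p. p"] by (simp add: image_image)
  have "embedding (substr N (fst ` P)) N' f"
    unfolding embedding_def
  proof (intro conjI)
    show "f ` carrier (substr N (fst ` P)) \<subseteq> carrier N'"
      using fP assms unfolding partial_iso_def by auto
    show "inj_on f (carrier (substr N (fst ` P)))"
      using fP main(1)[OF fP fP] by (auto simp: inj_on_def)
    show "\<forall>x\<in>carrier (substr N (fst ` P)). \<forall>y\<in>carrier (substr N (fst ` P)).
        ((x, y) \<in> relR (substr N (fst ` P))) = ((f x, f y) \<in> relR N')"
      using main(2)[OF fP fP] by simp
    show "\<forall>x\<in>carrier (substr N (fst ` P)). \<forall>y\<in>carrier (substr N (fst ` P)).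
        \<forall>z\<in>carrier (substr N (fst ` P)). \<forall>w\<in>carrier (substr N (fst ` P)).
        ((x, y, z, w) \<in> relS (substr N (fst ` P))) = ((f x, f y, f z, f w) \<in> relS N')"
      using main(3)[OF fP fP fP fP] by simp
  qed
  then show ?thesis by (rule that[OF P])
qed

lemma isomorphism_partial_iso:
  assumes "partial_iso N N' U" "fst ` U = carrier N" "snd ` U = carrier N'" "lstructure N"
  shows "isomorphic N N'"
proof -
  obtain f where f: "U = (\<lambda>a. (a, f a)) ` fst ` U" "embedding (substr N (fst ` U)) N' f"
    using partial_iso_function[OF assms(1)] .
  have "embedding N N' f"
    using f(2) assms(2) by (simp add: embedding_def)
  moreover have "f ` carrier N = carrier N'"
    using arg_cong[OF f(1), of "image snd"] assms(2,3) by (simp add: image_image)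
  ultimately show ?thesis unfolding isomorphic_def isomorphism_def by blast
qed

lemma back_and_forth:
  assumes cN: "countable (carrier N)" and cN': "countable (carrier N')" and "lstructure N"
    and forth: "\<And>P x. finite P \<Longrightarrow> partial_iso N N' P \<Longrightarrow> x \<in> carrier N \<Longrightarrow>
        \<exists>y. partial_iso N N' (insert (x, y) P)"
    and conv: "\<And>P x. finite P \<Longrightarrow> partial_iso N' N P \<Longrightarrow> x \<in> carrier N' \<Longrightarrow>
        \<exists>y. partial_iso N' N (insert (x, y) P)"
  shows "isomorphic N N'"
proof -
  define good where "good P \<longleftrightarrow> finite P \<and> partial_iso N N' P" for P
  have step: "\<exists>Q. good Q \<and> P \<subseteq> Q \<and>
      (\<forall>x \<in> carrier N. to_nat_on (carrier N) x = n \<longrightarrow> x \<in> fst ` Q) \<and>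
      (\<forall>x \<in> carrier N'. to_nat_on (carrier N') x = n \<longrightarrow> x \<in> snd ` Q)" if P: "good P" for P n
  proof -
    have "\<exists>Q. good Q \<and> P \<subseteq> Q \<and> (\<forall>x \<in> carrier N. to_nat_on (carrier N) x = n \<longrightarrow> x \<in> fst ` Q)"
    proof (cases "\<exists>x\<in>carrier N. to_nat_on (carrier N) x = n")
      case True
      then obtain x where x: "x \<in> carrier N" "to_nat_on (carrier N) x = n" by blast
      then obtain y where "good (insert (x, y) P)" using forth P unfolding good_def by blast
      moreover have "\<forall>x' \<in> carrier N. to_nat_on (carrier N) x' = n \<longrightarrow> x' \<in> fst ` insert (x, y) P"
        using x cN by (auto dest: inj_onD[OF inj_on_to_nat_on])
      ultimately show ?thesis by blast
    qed (use P in blast)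
    then obtain Q where Q: "good Q" "P \<subseteq> Q"
      "\<forall>x \<in> carrier N. to_nat_on (carrier N) x = n \<longrightarrow> x \<in> fst ` Q" by blast
    show ?thesis
    proof (cases "\<exists>x\<in>carrier N'. to_nat_on (carrier N') x = n")
      case True
      then obtain x where x: "x \<in> carrier N'" "to_nat_on (carrier N') x = n" by blast
      obtain y where "partial_iso N' N (insert (x, y) (Q\<inverse>))"
        using conv[of "Q\<inverse>" x] Q x unfolding good_def by (auto simp: partial_iso_converse)
      moreover have "(insert (y, x) Q)\<inverse> = insert (x, y) (Q\<inverse>)" by auto
      ultimately have "good (insert (y, x) Q)"
        using partial_iso_converse[of N' N "insert (y, x) Q"] Q unfolding good_def
        by simp
      moreover have "\<forall>x' \<in> carrier N'. to_nat_on (carrier N') x' = n \<longrightarrow> x' \<in> snd ` insert (y, x) Q"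
        using x cN' by (auto dest: inj_onD[OF inj_on_to_nat_on])
      ultimately show ?thesis using Q
        by (intro exI[of _ "insert (y, x) Q"]) auto
    qed (use Q in blast)
  qed
  have "good {}" by (simp add: good_def partial_iso_def)
  then have "\<exists>P. \<forall>n. good (P n) \<and> P n \<subseteq> P (Suc n) \<and>
      (\<forall>x \<in> carrier N. to_nat_on (carrier N) x = n \<longrightarrow> x \<in> fst ` P (Suc n)) \<and>
      (\<forall>x \<in> carrier N'. to_nat_on (carrier N') x = n \<longrightarrow> x \<in> snd ` P (Suc n))"
    using dependent_nat_choice[of "\<lambda>_. good" "\<lambda>n P Q. P \<subseteq> Q \<and>
      (\<forall>x \<in> carrier N. to_nat_on (carrier N) x = n \<longrightarrow> x \<in> fst ` Q) \<and>
      (\<forall>x \<in> carrier N'. to_nat_on (carrier N') x = n \<longrightarrow> x \<in> snd ` Q)"] step by blast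
  then obtain P where P: "\<And>n. good (P n)" "\<And>n. P n \<subseteq> P (Suc n)"
    "\<And>x. x \<in> carrier N \<Longrightarrow> x \<in> fst ` P (Suc (to_nat_on (carrier N) x))"
    "\<And>x. x \<in> carrier N' \<Longrightarrow> x \<in> snd ` P (Suc (to_nat_on (carrier N') x))" by blast
  define U where "U = (\<Union>n. P n)"
  have mono: "P m \<subseteq> P n" if "m \<le> n" for m n using lift_Suc_mono_le[of P] P(2) that by blast
  \<comment> \<open>A clause of \<open>partial_iso\<close> involves at most four pairs, and four
    pairs of the union already occur at a common stage.\<close>
  have four: "\<exists>n. {p, q, r, s} \<subseteq> P n" if pqrs: "p \<in> U" "q \<in> U" "r \<in> U" "s \<in> U" for p q r s
  proof -
    obtain i j k l where "p \<in> P i" "q \<in> P j" "r \<in> P k" "s \<in> P l"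
      using pqrs unfolding U_def by blast
    then have "{p, q, r, s} \<subseteq> P (max (max i j) (max k l))"
      using mono[of i] mono[of j] mono[of k] mono[of l]
      by (meson empty_subsetI insert_subset max.cobounded1 max.cobounded2 order_trans subsetD)
    then show ?thesis ..
  qed
  have "partial_iso N N' U"
    unfolding partial_iso_def
  proof (intro conjI)
    show "U \<subseteq> carrier N \<times> carrier N'" using P(1) unfolding U_def good_def partial_iso_def by blast
    have "(fst p = fst q \<longleftrightarrow> snd p = snd q) \<and> ((fst p, fst q) \<in> relR N \<longleftrightarrow> (snd p, snd q) \<in> relR N') \<and>
       ((fst p, fst q, fst r, fst s) \<in> relS N \<longleftrightarrow> (snd p, snd q, snd r, snd s) \<in> relS N')"
      if pqrs: "p \<in> U" "q \<in> U" "r \<in> U" "s \<in> U" for p q r s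
    proof -
      obtain n where "{p, q, r, s} \<subseteq> P n" using four[OF pqrs] by blast
      with P(1)[of n] show ?thesis unfolding good_def partial_iso_def by simp
    qed
    then show "\<forall>p\<in>U. \<forall>q\<in>U. (fst p = fst q \<longleftrightarrow> snd p = snd q) \<and>
       ((fst p, fst q) \<in> relR N \<longleftrightarrow> (snd p, snd q) \<in> relR N') \<and>
       (\<forall>r\<in>U. \<forall>s\<in>U. (fst p, fst q, fst r, fst s) \<in> relS N \<longleftrightarrow> (snd p, snd q, snd r, snd s) \<in> relS N')"
      by blast
  qed
  moreover from this have "U \<subseteq> carrier N \<times> carrier N'" by (simp add: partial_iso_def)
  then have "fst ` U \<subseteq> carrier N" "snd ` U \<subseteq> carrier N'" by auto
  moreover have "carrier N \<subseteq> fst ` U" "carrier N' \<subseteq> snd ` U"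
    using P(3,4) unfolding U_def by blast+
  ultimately show ?thesis using \<open>lstructure N\<close> by (intro isomorphism_partial_iso) auto
qed

section \<open>One-point extensions in the Fraisse limit\<close>

lemma Aut_embedding:
  assumes "g \<in> carrier (Aut N)"
  shows "embedding N N g"
  using assms by (simp add: Aut_def isomorphism_def)

text \<open>A copy of the finite structure on the domain of \<open>P\<close> together with
  \<open>x\<close> exists in \<open>M\<close>, but possibly in the wrong place; ultrahomogeneity
  moves it so that it continues \<open>P\<close>.\<close>

lemma fraisse_limit_extension:
  assumes M: "fraisse_limit class_D M" and K: "D_structure K"
    and P: "partial_iso K M P" "finite P" and x: "x \<in> carrier K"
  shows "\<exists>y. partial_iso K M (insert (x, y) P)"
proof -
  obtain f where f: "P = (\<lambda>a. (a, f a)) ` fst ` P" "embedding (substr K (fst ` P)) M f"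
    using partial_iso_function[OF P(1)] .
  define X where "X = insert x (fst ` P)"
  have X: "finite X" "X \<subseteq> carrier K" "x \<in> X" "fst ` P \<subseteq> X"
    using P x by (auto simp: X_def partial_iso_def)
  \<comment> \<open>The members of \<open>class_D\<close> live on \<open>nat\<close>, so the finite
    substructure is copied along an enumeration.\<close>
  define i where "i = to_nat_on X"
  define j where "j = inv_into X i"
  have ii: "inj_on i X" using X by (simp add: i_def inj_on_to_nat_on countable_finite)
  then have ji: "j (i a) = a" if "a \<in> X" for a using that by (simp add: j_def)
  define N where "N = \<lparr>carrier = i ` X, relR = {(u, v). u \<in> i ` X \<and> v \<in> i ` X \<and> (j u, j v) \<in> relR K},
    relS = {(u, v, w, z). u \<in> i ` X \<and> v \<in> i ` X \<and> w \<in> i ` X \<and> z \<in> i ` X \<and> (j u, j v, j w, j z) \<in> relS K}\<rparr>"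
  have jN: "embedding N K j"
    using X ji by (auto simp: embedding_def N_def inj_on_def)
  have "lstructure N" by (auto simp: N_def lstructure_def)
  then have "D_structure N" using jN K by (rule D_structure_embedding)
  then have "N \<in> class_D" using X by (auto simp: class_D_def D_structure_def N_def)
  then obtain Z where Z: "Z \<subseteq> carrier M" "isomorphic N (substr M Z)"
    using M unfolding fraisse_limit_def by blast
  then obtain e where "embedding N (substr M Z) e" by (auto simp: isomorphic_def isomorphism_def)
  from embedding_comp[OF this embedding_substr_id[OF Z(1)]] have e: "embedding N M e"
    by (simp add: comp_def)
  have iN: "embedding (substr K X) N i"
    using ii ji by (auto simp: embedding_def N_def)
  define \<psi> where "\<psi> = e \<circ> i"
  have \<psi>: "embedding (substr K X) M \<psi>" unfolding \<psi>_def using iN e by (rule embedding_comp)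
  let ?X = "fst ` P"
  have inj: "inj_on \<psi> X" using \<psi> by (simp add: embedding_def)
  then have inj': "inj_on \<psi> ?X" using X(4) inj_on_subset by blast
  \<comment> \<open>\<open>\<theta>\<close> carries the copy of the old domain to its required image
    under \<open>f\<close>; it is the finite isomorphism to be extended to an automorphism.\<close>
  define \<theta> where "\<theta> = f \<circ> inv_into ?X \<psi>"
  have \<theta>: "\<theta> (\<psi> a) = f a" if "a \<in> ?X" for a using that inj' by (simp add: \<theta>_def)
  have "embedding (substr M (\<psi> ` ?X)) (substr M (f ` ?X)) \<theta>"
    unfolding embedding_def
  proof (intro conjI)
    show "inj_on \<theta> (carrier (substr M (\<psi> ` ?X)))"
      using f(2) \<theta> by (auto simp: inj_on_def embedding_def)
    show "\<theta> ` carrier (substr M (\<psi> ` ?X)) \<subseteq> carrier (substr M (f ` ?X))"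
      using \<theta> by auto
  qed (use f(2) \<psi> X(4) \<theta> in \<open>simp_all add: embedding_def subset_iff\<close>)
  moreover have "\<theta> ` \<psi> ` ?X = f ` ?X"
    unfolding image_image[of \<theta>] using \<theta> by (rule image_cong[OF refl])
  ultimately have "isomorphism (substr M (\<psi> ` ?X)) (substr M (f ` ?X)) \<theta>"
    by (simp add: isomorphism_def)
  moreover have "\<psi> ` ?X \<subseteq> carrier M" "f ` ?X \<subseteq> carrier M"
    using \<psi> f(2) X(4) by (auto simp: embedding_def)
  moreover have "finite (\<psi> ` ?X)" "finite (f ` ?X)" using P(2) by auto
  moreover have "ultrahomogeneous M" using M by (simp add: fraisse_limit_def)
  ultimately obtain g where g: "g \<in> carrier (Aut M)" "\<forall>u\<in>\<psi> ` ?X. g u = \<theta> u"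
    unfolding ultrahomogeneous_def by metis
  have "embedding (substr K X) M (g \<circ> \<psi>)"
    using \<psi> Aut_embedding[OF g(1)] by (rule embedding_comp)
  from partial_iso_graph[OF this X(2)] have "partial_iso K M ((\<lambda>a. (a, (g \<circ> \<psi>) a)) ` X)" .
  moreover have "(\<lambda>a. (a, (g \<circ> \<psi>) a)) ` X = insert (x, g (\<psi> x)) P"
  proof -
    have "(\<lambda>a. (a, (g \<circ> \<psi>) a)) ` ?X = (\<lambda>a. (a, f a)) ` ?X"
      using g(2) \<theta> by (intro image_cong) auto
    also have "\<dots> = P" by (rule f(1)[symmetric])
    finally show ?thesis by (simp only: X_def image_insert comp_apply)
  qed
  ultimately have "partial_iso K M (insert (x, g (\<psi> x)) P)" by (simp only:)
  then show ?thesis ..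
qed

section \<open>Hereditarily finite terms\<close>

text \<open>The lists in \<open>rels\<close> of length two and four are the prescribed tuples of \<open>R\<close> and \<open>S\<close>; \<^const>\<open>None\<close>
  stands for the term itself.\<close>

datatype 'y pt = Pt (base: 'y) (below: "'y pt list") (rels: "'y pt option list list")

instance pt :: (countable) countable
  by countable_datatype

text \<open>Leaves are erased so that the action visibly preserves the size. Exchanged terms thus
  have equal rank, while \<open>rank_below\<close> separates a term from those on its list.\<close>

definition rank :: "'y pt \<Rightarrow> nat" where
  "rank x = size (map_pt (\<lambda>_. ()) x)"

lemma rank_map [simp]: "rank (map_pt g x) = rank x"
  by (simp add: rank_def pt.map_comp comp_def)

lemma rank_below: "y \<in> set (below x) \<Longrightarrow> rank y < rank x"
  by (cases x) (auto simp: rank_def less_Suc_eq_le intro!: trans_le_add1 size_list_estimation')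

lemma map_pt_eqD: "map_pt g x = map_pt h x \<Longrightarrow> z \<in> set_pt x \<Longrightarrow> g z = h z"
proof (induction x)
  case (Pt b fs rs)
  then show ?case
    by (auto simp: map_eq_conv) (metis in_set_conv_nth option.map_sel option.set_sel option.sel option.simps(9))
qed

text \<open>Equality of images is decided leaf by leaf, which reduces equations between powers of a
  group element on terms to equations on the underlying set.\<close>

lemma map_pt_cong_iff: "map_pt g x = map_pt h x \<longleftrightarrow> (\<forall>z\<in>set_pt x. g z = h z)"
  using map_pt_eqD[of g x h] pt.map_cong[of x x g h] by blast

lemma base_in_set_pt [simp]: "base x \<in> set_pt x"
  by (cases x) simp

lemma base_map [simp]: "base (map_pt g x) = g (base x)"
  and below_map [simp]: "below (map_pt g x) = map (map_pt g) (below x)"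
  and rels_map [simp]: "rels (map_pt g x) = map (map (map_option (map_pt g))) (rels x)"
  by (cases x; simp)+

lemma set_pt_below: "y \<in> set (below x) \<Longrightarrow> set_pt y \<subseteq> set_pt x"
  by (cases x) auto

lemma set_pt_rels: "l \<in> set (rels x) \<Longrightarrow> Some y \<in> set l \<Longrightarrow> set_pt y \<subseteq> set_pt x"
  by (cases x) force

section \<open>Actions admitting invariant relations\<close>

text \<open>A transposition or a 3-cycle has a fixed point beside an orbit of length two or three,
  against \<open>fixp\<close>; a 4-cycle violates \<open>four\<close>. The identity and the three
  double transpositions remain.\<close>

lemma permutation_of_four:
  assumes d: "distinct [a, b, c, d]" and im: "f ` {a, b, c, d} = {a, b, c, d}"
    and fixp: "\<And>x z. x \<in> {a, b, c, d} \<Longrightarrow> z \<in> {a, b, c, d} \<Longrightarrow> f x = x \<Longrightarrow>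
      f (f z) = z \<or> f (f (f z)) = z \<Longrightarrow> f z = z"
    and four: "\<And>z. z \<in> {a, b, c, d} \<Longrightarrow> f (f (f (f z))) = z \<Longrightarrow> f (f z) = z"
  shows "map f [a, b, c, d] \<in> {[a, b, c, d], [b, a, d, c], [c, d, a, b], [d, c, b, a]}"
proof -
  have "f a \<in> {a, b, c, d}" "f b \<in> {a, b, c, d}" "f c \<in> {a, b, c, d}" "f d \<in> {a, b, c, d}"
    using im by blast+
  moreover have "card (f ` {a, b, c, d}) = card {a, b, c, d}" by (simp only: im)
  then have "inj_on f {a, b, c, d}" by (intro eq_card_imp_inj_on) auto
  then have "distinct [f a, f b, f c, f d]" using d by (auto simp: inj_on_def)
  ultimately show ?thesis
    using d
    by (elim insertE emptyE; (simp; fail | use fixp[of a b] fixp[of a c] fixp[of b a] fixp[of b c]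
      fixp[of c a] fixp[of c b] fixp[of d a] fixp[of d b] four[of a] four[of b] in \<open>simp; fail\<close>))
qed

text \<open>On lists of length four this is the symmetry built into a semifinal structure, from
  \<open>(b0, b1, b2, b3)\<close> to \<open>(b2, b3, b0, b1)\<close>.\<close>

definition rot :: "'a list \<Rightarrow> 'a list" where
  "rot t = drop 2 t @ take 2 t"

lemma rot_map [simp]: "map f (rot t) = rot (map f t)"
  by (simp add: rot_def drop_map take_map)

lemma set_rot [simp]: "set (rot t) = set t"
  unfolding rot_def set_append by (metis Un_commute append_take_drop_id set_append)

lemma rot_four [simp]: "rot [a, b, c, d] = [c, d, a, b]"
  by (simp add: rot_def)

lemma rot_rot [simp]: "length t = 4 \<Longrightarrow> rot (rot t) = t"
  by (auto simp: numeral_eq_Suc length_Suc_conv rot_def)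

text \<open>Inverses are required on \<open>Y\<close> only, so that plain total functions can serve
  as group elements. \<open>no_fixed_point\<close>, \<open>no_four_cycle\<close> and
  \<open>no_klein_four\<close> allow invariant enumerations of four-element sets;
  \<open>no_swap_triangle\<close>, again with \<open>no_fixed_point\<close>, keeps the graph free of
  independent triples.\<close>

locale good_action =
  fixes G :: "('y \<Rightarrow> 'y) set" and Y :: "'y set"
  assumes countable_Y: "countable Y"
    and G_closed: "\<And>g y. g \<in> G \<Longrightarrow> y \<in> Y \<Longrightarrow> g y \<in> Y"
    and G_id: "(\<lambda>y. y) \<in> G"
    and G_comp: "\<And>g h. g \<in> G \<Longrightarrow> h \<in> G \<Longrightarrow> g \<circ> h \<in> G"
    and G_inv: "\<And>g. g \<in> G \<Longrightarrow> \<exists>h\<in>G. \<forall>y\<in>Y. h (g y) = y \<and> g (h y) = y"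
    and Y_nonempty: "Y \<noteq> {}"
    and no_fixed_point: "\<And>g y z. g \<in> G \<Longrightarrow> y \<in> Y \<Longrightarrow> g y = y \<Longrightarrow> z \<in> Y \<Longrightarrow>
      g (g z) = z \<or> g (g (g z)) = z \<Longrightarrow> g z = z"
    and no_four_cycle: "\<And>g z. g \<in> G \<Longrightarrow> z \<in> Y \<Longrightarrow> g (g (g (g z))) = z \<Longrightarrow> g (g z) = z"
    and no_klein_four: "\<And>g h a b c d. g \<in> G \<Longrightarrow> h \<in> G \<Longrightarrow> {a, b, c, d} \<subseteq> Y \<Longrightarrow> distinct [a, b, c, d] \<Longrightarrow>
      map g [a, b, c, d] = [b, a, d, c] \<Longrightarrow> map h [a, b, c, d] = [c, d, a, b] \<Longrightarrow> False"
    and no_swap_triangle: "\<And>f g h a b c. f \<in> G \<Longrightarrow> g \<in> G \<Longrightarrow> h \<in> G \<Longrightarrow> {a, b, c} \<subseteq> Y \<Longrightarrow> distinct [a, b, c] \<Longrightarrow>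
      f a = b \<Longrightarrow> f b = a \<Longrightarrow> g b = c \<Longrightarrow> g c = b \<Longrightarrow> h a = c \<Longrightarrow> h c = a \<Longrightarrow> False"
begin

section \<open>Lifting the action to terms\<close>

definition pts :: "'y pt set" where
  "pts = {x. set_pt x \<subseteq> Y}"

abbreviation act :: "('y \<Rightarrow> 'y) \<Rightarrow> 'y pt \<Rightarrow> 'y pt" where
  "act \<equiv> map_pt"

lemma act_pts: "g \<in> G \<Longrightarrow> x \<in> pts \<Longrightarrow> act g x \<in> pts"
  using G_closed by (auto simp: pts_def pt.set_map)

lemma base_Y: "x \<in> pts \<Longrightarrow> base x \<in> Y"
  using base_in_set_pt by (auto simp: pts_def)

lemma below_pts: "x \<in> pts \<Longrightarrow> set (below x) \<subseteq> pts"
  using set_pt_below by (fastforce simp: pts_def)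

lemma act_inverse:
  assumes "g \<in> G"
  obtains h where "h \<in> G" "\<And>x. x \<in> pts \<Longrightarrow> act h (act g x) = x" "\<And>x. x \<in> pts \<Longrightarrow> act g (act h x) = x"
proof -
  obtain h where h: "h \<in> G" "\<forall>y\<in>Y. h (g y) = y \<and> g (h y) = y" using G_inv[OF assms] by blast
  have "act h (act g x) = x \<and> act g (act h x) = x" if "x \<in> pts" for x
    using map_pt_cong_iff[of "h \<circ> g" x "\<lambda>y. y"] map_pt_cong_iff[of "g \<circ> h" x "\<lambda>y. y"] h(2) that
    by (auto simp: pt.map_comp pt.map_ident pts_def)
  with h(1) that show ?thesis by blast
qed

lemma act_eq_iff: "g \<in> G \<Longrightarrow> x \<in> pts \<Longrightarrow> y \<in> pts \<Longrightarrow> act g x = act g y \<longleftrightarrow> x = y"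
  by (metis act_inverse)

lemma act_eq_self: "act g x = x \<longleftrightarrow> (\<forall>z\<in>set_pt x. g z = z)"
  using map_pt_cong_iff[of g x "\<lambda>y. y"] by (simp add: pt.map_ident)

lemma act2_eq_self: "act g (act g x) = x \<longleftrightarrow> (\<forall>z\<in>set_pt x. g (g z) = z)"
  using act_eq_self[of "g \<circ> g" x] by (simp add: pt.map_comp)

lemma act3_eq_self: "act g (act g (act g x)) = x \<longleftrightarrow> (\<forall>z\<in>set_pt x. g (g (g z)) = z)"
  using act_eq_self[of "g \<circ> (g \<circ> g)" x] by (simp add: pt.map_comp)

lemma act4_eq_self: "act g (act g (act g (act g x))) = x \<longleftrightarrow> (\<forall>z\<in>set_pt x. g (g (g (g z))) = z)"
  using act_eq_self[of "g \<circ> (g \<circ> (g \<circ> g))" x] by (simp add: pt.map_comp)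

text \<open>The equation for \<open>x\<close> holds at each of its leaves, and
  \<open>no_fixed_point\<close> applies to each leaf with the same fixed \<open>y\<close>.\<close>

lemma act_no_fixed_point:
  assumes "g \<in> G" "y \<in> Y" "g y = y" "x \<in> pts" "act g (act g x) = x \<or> act g (act g (act g x)) = x"
  shows "act g x = x"
  using assms no_fixed_point[of g y] unfolding act_eq_self act2_eq_self act3_eq_self pts_def by blast

lemma act_no_four_cycle:
  "g \<in> G \<Longrightarrow> x \<in> pts \<Longrightarrow> act g (act g (act g (act g x))) = x \<Longrightarrow> act g (act g x) = x"
  using no_four_cycle unfolding act4_eq_self act2_eq_self pts_def by blast

text \<open>A common base would be fixed by \<open>g\<close>, which then could not exchange two
  terms. Forbidden configurations of terms thereby project to configurations of distinct elements of
  \<open>Y\<close>.\<close>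

lemma base_neq_if_swapped:
  assumes "g \<in> G" "x \<in> pts" "act g x = y" "act g y = x" "x \<noteq> y"
  shows "base x \<noteq> base y"
proof
  assume "base x = base y"
  then have "g (base x) = base x" using assms(3) base_map[of g x] by simp
  with act_no_fixed_point[of g "base x" x] base_Y[of x] assms show False by simp
qed

lemma act_no_klein_four:
  assumes gh: "g \<in> G" "h \<in> G" and P: "{a, b, c, d} \<subseteq> pts" and d: "distinct [a, b, c, d]"
    and g: "map (act g) [a, b, c, d] = [b, a, d, c]" and h: "map (act h) [a, b, c, d] = [c, d, a, b]"
  shows False
proof (rule no_klein_four[of g h "base a" "base b" "base c" "base d"])
  \<comment> \<open>The product is the third double transposition; it separates the bases of
    \<open>a\<close> and \<open>d\<close>, and of \<open>b\<close> and \<open>c\<close>.\<close>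
  have k: "g \<circ> h \<in> G" using gh by (rule G_comp)
  have ge: "act g a = b" "act g b = a" "act g c = d" "act g d = c"
    and he: "act h a = c" "act h b = d" "act h c = a" "act h d = b" using g h by auto
  have ke: "act (g \<circ> h) x = act g (act h x)" for x by (simp add: pt.map_comp)
  show "distinct [base a, base b, base c, base d]"
    using d P base_neq_if_swapped[OF gh(1), of a b] base_neq_if_swapped[OF gh(1), of c d]
      base_neq_if_swapped[OF gh(2), of a c] base_neq_if_swapped[OF gh(2), of b d]
      base_neq_if_swapped[OF k, of a d] base_neq_if_swapped[OF k, of b c]
    by (auto simp: ge he ke)
  show "{base a, base b, base c, base d} \<subseteq> Y" using P base_Y by auto
  show "map g [base a, base b, base c, base d] = [base b, base a, base d, base c]"
    using arg_cong[OF g, of "map base"] by simp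
  show "map h [base a, base b, base c, base d] = [base c, base d, base a, base b]"
    using arg_cong[OF h, of "map base"] by simp
qed (use gh in auto)

section \<open>Invariant choice of arcs\<close>

definition swappable :: "'y pt \<Rightarrow> 'y pt \<Rightarrow> bool" where
  "swappable x y \<longleftrightarrow> (\<exists>g\<in>G. act g x = y \<and> act g y = x)"

lemma swappable_rank: "swappable x y \<Longrightarrow> rank x = rank y"
  by (auto simp: swappable_def)

lemma act_no_swap_triangle:
  assumes P: "{a, b, c} \<subseteq> pts" and d: "distinct [a, b, c]"
    and s: "swappable a b" "swappable b c" "swappable a c"
  shows False
proof -
  obtain f g h where G: "f \<in> G" "g \<in> G" "h \<in> G"
    and e: "act f a = b" "act f b = a" "act g b = c" "act g c = b" "act h a = c" "act h c = a"
    using s unfolding swappable_def by blast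
  show False
  proof (rule no_swap_triangle[OF G])
    show "{base a, base b, base c} \<subseteq> Y" using P base_Y by auto
    show "distinct [base a, base b, base c]"
      using P d base_neq_if_swapped[OF G(1), of a b] base_neq_if_swapped[OF G(2), of b c]
        base_neq_if_swapped[OF G(3), of a c] e by auto
  qed (use e[symmetric] in \<open>metis base_map\<close>)+
qed

definition pair_orbit :: "'y pt \<Rightarrow> 'y pt \<Rightarrow> ('y pt \<times> 'y pt) set" where
  "pair_orbit x y = {(act g x, act g y) |g. g \<in> G}"

lemma pair_orbit_act:
  assumes "g \<in> G" "x \<in> pts" "y \<in> pts"
  shows "pair_orbit (act g x) (act g y) = pair_orbit x y"
proof
  show "pair_orbit (act g x) (act g y) \<subseteq> pair_orbit x y"
    using G_comp[OF _ assms(1)] by (fastforce simp: pair_orbit_def pt.map_comp)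
  obtain h where h: "h \<in> G" "act h (act g x) = x" "act h (act g y) = y"
    using act_inverse[OF assms(1)] assms by metis
  show "pair_orbit x y \<subseteq> pair_orbit (act g x) (act g y)"
  proof
    fix p assume "p \<in> pair_orbit x y"
    then obtain k where k: "k \<in> G" "p = (act k x, act k y)" by (auto simp: pair_orbit_def)
    then have "p = (act (k \<circ> h) (act g x), act (k \<circ> h) (act g y))"
      using h by (simp flip: pt.map_comp[of k h])
    then show "p \<in> pair_orbit (act g x) (act g y)"
      using G_comp[OF k(1) h(1)] by (auto simp: pair_orbit_def)
  qed
qed

lemma pair_orbit_sym_imp_swappable: "pair_orbit x y = pair_orbit y x \<Longrightarrow> swappable x y"
proof -
  assume "pair_orbit x y = pair_orbit y x"
  moreover have "(x, y) \<in> pair_orbit x y"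
    unfolding pair_orbit_def using G_id by (auto simp: pt.map_ident intro!: exI[of _ "\<lambda>y. y"])
  ultimately have "(x, y) \<in> pair_orbit y x" by (simp only:)
  then obtain g where "g \<in> G" "x = act g y" "y = act g x"
    unfolding pair_orbit_def by blast
  then show ?thesis unfolding swappable_def by metis
qed

definition orbit_order :: "(('y pt \<times> 'y pt) set) rel" where
  "orbit_order = (SOME r. well_order_on UNIV r)"

lemma orbit_order: "antisym orbit_order" "total orbit_order"
proof -
  have "well_order_on UNIV orbit_order"
    unfolding orbit_order_def by (rule someI_ex) (rule well_order_on)
  then show "antisym orbit_order" "total orbit_order"
    by (simp_all add: well_order_on_def linear_order_on_def partial_order_on_def)
qed

text \<open>If no group element exchanges \<open>x\<close> and \<open>y\<close>, the orbits of
  \<open>(x, y)\<close> and \<open>(y, x)\<close> differ, and the order on orbits selects one of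
  them. Comparing orbits and not points makes the choice invariant.\<close>

definition default_R :: "'y pt \<Rightarrow> 'y pt \<Rightarrow> bool" where
  "default_R x y \<longleftrightarrow> pair_orbit x y \<noteq> pair_orbit y x \<and> (pair_orbit x y, pair_orbit y x) \<in> orbit_order"

lemma default_R_asym: "default_R x y \<Longrightarrow> \<not> default_R y x"
  using orbit_order(1) by (auto simp: default_R_def antisym_def)

lemma default_R_total: "\<not> default_R x y \<Longrightarrow> \<not> default_R y x \<Longrightarrow> swappable x y"
  using orbit_order(2) by (auto simp: default_R_def total_on_def intro: pair_orbit_sym_imp_swappable)

section \<open>Invariant choice of enumerations of four-element sets\<close>

definition rigid_tuple :: "'y pt list \<Rightarrow> bool" where
  "rigid_tuple t \<longleftrightarrow> length t = 4 \<and> distinct t \<and> set t \<subseteq> pts \<and>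
     (\<forall>g\<in>G. act g ` set t = set t \<longrightarrow> map (act g) t \<in> {t, rot t})"

text \<open>Besides the identity, the setwise stabiliser induces at most one double transposition,
  since two different ones are excluded by \<open>act_no_klein_four\<close>. Placing exchanged
  points two positions apart turns it into \<open>rot\<close>.\<close>

lemma ex_rigid_tuple:
  assumes "B \<subseteq> pts" "card B = 4"
  shows "\<exists>t. rigid_tuple t \<and> set t = B"
proof -
  obtain a b c d where B: "B = {a, b, c, d}" and d: "distinct [a, b, c, d]"
    using assms(2) by (auto simp: card_Suc_eq numeral_eq_Suc)
  have pts: "a \<in> pts" "b \<in> pts" "c \<in> pts" "d \<in> pts" using assms(1) B by auto
  have perm: "map (act g) [a, b, c, d] \<in> {[a, b, c, d], [b, a, d, c], [c, d, a, b], [d, c, b, a]}"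
    if g: "g \<in> G" "act g ` B = B" for g
  proof (rule permutation_of_four)
    show "act g ` {a, b, c, d} = {a, b, c, d}" using g(2) unfolding B .
  next
    fix x z assume xz: "x \<in> {a, b, c, d}" "z \<in> {a, b, c, d}" and x: "act g x = x"
      and z: "act g (act g z) = z \<or> act g (act g (act g z)) = z"
    have "x \<in> pts" "z \<in> pts" using xz pts by blast+
    moreover have "g (base x) = base x" using base_map[of g x] x by simp
    ultimately show "act g z = z"
      using act_no_fixed_point[OF g(1) base_Y _ _ z] by blast
  next
    fix z assume "z \<in> {a, b, c, d}" "act g (act g (act g (act g z))) = z"
    moreover from this have "z \<in> pts" using pts by blast
    ultimately show "act g (act g z) = z" using act_no_four_cycle[OF g(1)] by blast
  qed (rule d)
  let ?P = "\<lambda>t. \<exists>g\<in>G. map (act g) [a, b, c, d] = t"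
  \<comment> \<open>Each two of the three double transpositions exclude each other, after renaming
    the four points.\<close>
  have no12: False if P: "?P [b, a, d, c]" "?P [c, d, a, b]"
  proof -
    obtain g where g: "g \<in> G" "map (act g) [a, b, c, d] = [b, a, d, c]" using P(1) by (rule bexE)
    obtain h where h: "h \<in> G" "map (act h) [a, b, c, d] = [c, d, a, b]" using P(2) by (rule bexE)
    show False
      by (rule act_no_klein_four[of g h a b c d]) (use pts d g h in auto)
  qed
  have no13: False if P: "?P [b, a, d, c]" "?P [d, c, b, a]"
  proof -
    obtain g where g: "g \<in> G" "map (act g) [a, b, c, d] = [b, a, d, c]" using P(1) by (rule bexE)
    obtain h where h: "h \<in> G" "map (act h) [a, b, c, d] = [d, c, b, a]" using P(2) by (rule bexE)
    show False
      by (rule act_no_klein_four[of g h a b d c]) (use pts d g h in auto)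
  qed
  have no23: False if P: "?P [c, d, a, b]" "?P [d, c, b, a]"
  proof -
    obtain g where g: "g \<in> G" "map (act g) [a, b, c, d] = [c, d, a, b]" using P(1) by (rule bexE)
    obtain h where h: "h \<in> G" "map (act h) [a, b, c, d] = [d, c, b, a]" using P(2) by (rule bexE)
    show False
      by (rule act_no_klein_four[of g h a c d b]) (use pts d g h in auto)
  qed
  have rigid: "\<exists>t. rigid_tuple t \<and> set t = B" if "set t = B" "length t = 4"
    "\<And>g. g \<in> G \<Longrightarrow> act g ` B = B \<Longrightarrow> map (act g) t = t \<or> map (act g) t = rot t" for t
  proof -
    have "distinct t" using that(1,2) assms(2) by (simp add: card_distinct)
    then have "rigid_tuple t" unfolding rigid_tuple_def that(1) using that(2,3) assms(1) by simp
    with that(1) show ?thesis by blast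
  qed
  consider "?P [b, a, d, c]" | "?P [c, d, a, b]" | "?P [d, c, b, a]"
    | "\<not> ?P [b, a, d, c]" "\<not> ?P [c, d, a, b]" "\<not> ?P [d, c, b, a]" by blast
  then show ?thesis
  proof cases
    \<comment> \<open>Here \<open>a\<close> is exchanged with \<open>b\<close> and \<open>c\<close>
      with \<open>d\<close>, hence the order \<open>a, c, b, d\<close>; the third case takes
      \<open>a, b, d, c\<close> for the same reason.\<close>
    case 1
    show ?thesis
    proof (rule rigid)
      fix g assume g: "g \<in> G" "act g ` B = B"
      have n0: "map (act g) [a, b, c, d] \<noteq> [c, d, a, b]"
        by (rule notI, rule no12[OF 1], rule bexI[OF _ g(1)])
      have n1: "map (act g) [a, b, c, d] \<noteq> [d, c, b, a]"
        by (rule notI, rule no13[OF 1], rule bexI[OF _ g(1)])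
      have "map (act g) [a, b, c, d] \<in> {[a, b, c, d], [b, a, d, c]}"
        using perm[OF g] n0 n1 by (simp only: insert_iff empty_iff) simp
      then show "map (act g) [a, c, b, d] = [a, c, b, d] \<or> map (act g) [a, c, b, d] = rot [a, c, b, d]" by auto
    qed (use B in auto)
  next
    case 2
    show ?thesis
    proof (rule rigid)
      fix g assume g: "g \<in> G" "act g ` B = B"
      have n0: "map (act g) [a, b, c, d] \<noteq> [b, a, d, c]"
        by (rule notI, rule no12[OF _ 2], rule bexI[OF _ g(1)])
      have n1: "map (act g) [a, b, c, d] \<noteq> [d, c, b, a]"
        by (rule notI, rule no23[OF 2], rule bexI[OF _ g(1)])
      have "map (act g) [a, b, c, d] \<in> {[a, b, c, d], [c, d, a, b]}"
        using perm[OF g] n0 n1 by (simp only: insert_iff empty_iff) simp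
      then show "map (act g) [a, b, c, d] = [a, b, c, d] \<or> map (act g) [a, b, c, d] = rot [a, b, c, d]" by auto
    qed (use B in auto)
  next
    case 3
    show ?thesis
    proof (rule rigid)
      fix g assume g: "g \<in> G" "act g ` B = B"
      have n0: "map (act g) [a, b, c, d] \<noteq> [b, a, d, c]"
        by (rule notI, rule no13[OF _ 3], rule bexI[OF _ g(1)])
      have n1: "map (act g) [a, b, c, d] \<noteq> [c, d, a, b]"
        by (rule notI, rule no23[OF _ 3], rule bexI[OF _ g(1)])
      have "map (act g) [a, b, c, d] \<in> {[a, b, c, d], [d, c, b, a]}"
        using perm[OF g] n0 n1 by (simp only: insert_iff empty_iff) simp
      then show "map (act g) [a, b, d, c] = [a, b, d, c] \<or> map (act g) [a, b, d, c] = rot [a, b, d, c]" by auto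
    qed (use B in auto)
  next
    case 4
    show ?thesis
    proof (rule rigid)
      fix g assume g: "g \<in> G" "act g ` B = B"
      have n0: "map (act g) [a, b, c, d] \<noteq> [b, a, d, c]"
        by (rule notI, rule notE[OF 4(1)], rule bexI[OF _ g(1)])
      have n1: "map (act g) [a, b, c, d] \<noteq> [d, c, b, a]"
        by (rule notI, rule notE[OF 4(3)], rule bexI[OF _ g(1)])
      have "map (act g) [a, b, c, d] \<in> {[a, b, c, d], [c, d, a, b]}"
        using perm[OF g] n0 n1 by (simp only: insert_iff empty_iff) simp
      then show "map (act g) [a, b, c, d] = [a, b, c, d] \<or> map (act g) [a, b, c, d] = rot [a, b, c, d]" by auto
    qed (use B in auto)
  qed
qed

definition set_orbit :: "'y pt set \<Rightarrow> 'y pt set set" where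
  "set_orbit B = {act g ` B |g. g \<in> G}"

lemma set_orbit_act:
  assumes "g \<in> G" "B \<subseteq> pts"
  shows "set_orbit (act g ` B) = set_orbit B"
proof
  show "set_orbit (act g ` B) \<subseteq> set_orbit B"
    using G_comp[OF _ assms(1)] by (fastforce simp: set_orbit_def image_image pt.map_comp)
  obtain h where h: "h \<in> G" "\<And>x. x \<in> pts \<Longrightarrow> act h (act g x) = x"
    using act_inverse[OF assms(1)] by metis
  show "set_orbit B \<subseteq> set_orbit (act g ` B)"
  proof
    fix C assume "C \<in> set_orbit B"
    then obtain k where k: "k \<in> G" "C = act k ` B" by (auto simp: set_orbit_def)
    have "act k ` B = (\<lambda>x. act (k \<circ> h) (act g x)) ` B"
      using h assms(2) by (intro image_cong refl) (auto simp flip: pt.map_comp[of k h])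
    then have "C = act (k \<circ> h) ` act g ` B"
      using k(2) by (simp only: image_image)
    then show "C \<in> set_orbit (act g ` B)"
      using G_comp[OF k(1) h(1)] by (auto simp: set_orbit_def)
  qed
qed

definition orbit_tuple :: "'y pt set set \<Rightarrow> 'y pt list" where
  "orbit_tuple X = (SOME t. rigid_tuple t \<and> set_orbit (set t) = X)"

definition default_S :: "'y pt list \<Rightarrow> bool" where
  "default_S t \<longleftrightarrow> (\<exists>g\<in>G. t = map (act g) (orbit_tuple (set_orbit (set t))) \<or>
     t = rot (map (act g) (orbit_tuple (set_orbit (set t)))))"

lemma default_S_act_imp:
  assumes "g \<in> G" "set t \<subseteq> pts" "default_S t"
  shows "default_S (map (act g) t)"
proof -
  define r where "r = orbit_tuple (set_orbit (set t))"
  have r: "orbit_tuple (set_orbit (set (map (act g) t))) = r"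
    using set_orbit_act[OF assms(1,2)] by (simp add: r_def)
  obtain k where k: "k \<in> G" "t = map (act k) r \<or> t = rot (map (act k) r)"
    using assms(3) unfolding default_S_def r_def[symmetric] by blast
  have "map (act g) (map (act k) r) = map (act (g \<circ> k)) r" by (simp add: pt.map_comp)
  then have "map (act g) t = map (act (g \<circ> k)) r \<or> map (act g) t = rot (map (act (g \<circ> k)) r)"
    using k(2) by (metis rot_map)
  then show ?thesis
    unfolding default_S_def r using G_comp[OF assms(1) k(1)] by blast
qed

lemma default_S_act:
  assumes "g \<in> G" "set t \<subseteq> pts"
  shows "default_S (map (act g) t) \<longleftrightarrow> default_S t"
proof
  obtain h where h: "h \<in> G" "\<And>x. x \<in> pts \<Longrightarrow> act h (act g x) = x"
    using act_inverse[OF assms(1)] by metis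
  assume *: "default_S (map (act g) t)"
  have "set (map (act g) t) \<subseteq> pts" using assms act_pts by auto
  from default_S_act_imp[OF h(1) this *] have "default_S (map (act h) (map (act g) t))" .
  moreover have "map (act h) (map (act g) t) = t"
    using h(2) assms(2) by (simp add: map_idI subset_iff)
  ultimately show "default_S t" by (simp only:)
qed (use assms default_S_act_imp in blast)

lemma default_S_semifinal:
  assumes "B \<subseteq> pts" "card B = 4"
  obtains t where "length t = 4" "set t = B"
    "\<And>u. set u = B \<Longrightarrow> default_S u \<longleftrightarrow> u = t \<or> u = rot t"
proof -
  define r where "r = orbit_tuple (set_orbit B)"
  have r: "rigid_tuple r" "set_orbit (set r) = set_orbit B"
    using someI_ex[of "\<lambda>t. rigid_tuple t \<and> set_orbit (set t) = set_orbit B"] ex_rigid_tuple[OF assms]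
    unfolding r_def orbit_tuple_def by auto
  have "B \<in> set_orbit B"
    unfolding set_orbit_def using G_id by (auto simp: pt.map_ident intro!: exI[of _ "\<lambda>y. y"])
  then have "B \<in> set_orbit (set r)" by (simp only: r(2))
  then obtain h where h: "h \<in> G" "B = act h ` set r" unfolding set_orbit_def by blast
  obtain k where k: "k \<in> G" "\<And>x. x \<in> pts \<Longrightarrow> act k (act h x) = x" "\<And>x. x \<in> pts \<Longrightarrow> act h (act k x) = x"
    using act_inverse[OF h(1)] by metis
  have rp: "set r \<subseteq> pts" and rl: "length r = 4" using r(1) by (auto simp: rigid_tuple_def)
  \<comment> \<open>\<open>g\<close> and \<open>h\<close> carry \<open>set r\<close> to the same
    set, so \<open>k \<circ> g\<close> stabilises \<open>set r\<close> and rigidity of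
    \<open>r\<close> applies to it.\<close>
  have key: "map (act g) r = map (act h) r \<or> map (act g) r = rot (map (act h) r)"
    if g: "g \<in> G" "act g ` set r = B" for g
  proof -
    have "act (k \<circ> g) ` set r = act k ` act h ` set r"
      using g(2) h(2) by (simp add: image_image pt.map_comp[symmetric])
        (metis image_image)
    also have "\<dots> = set r" using k(2) rp by (force simp: image_image)
    finally have "map (act (k \<circ> g)) r \<in> {r, rot r}"
      using r(1) G_comp[OF k(1) g(1)] by (auto simp: rigid_tuple_def)
    then have "map (act h) (map (act (k \<circ> g)) r) \<in> {map (act h) r, rot (map (act h) r)}"
      by (elim insertE emptyE) (simp_all only: rot_map insert_iff simp_thms)
    moreover have "map (act h) (map (act (k \<circ> g)) r) = map (act g) r"
      using k(3) rp act_pts[OF g(1)] by (auto simp flip: pt.map_comp[of k g])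
    ultimately show ?thesis by (simp only: insert_iff empty_iff simp_thms)
  qed
  have "default_S u \<longleftrightarrow> u = map (act h) r \<or> u = rot (map (act h) r)" if u: "set u = B" for u
  proof
    assume "default_S u"
    then obtain g where g: "g \<in> G" "u = map (act g) r \<or> u = rot (map (act g) r)"
      unfolding default_S_def u r_def by blast
    then have "act g ` set r = B" using u by auto
    from key[OF g(1) this] g(2) rl show "u = map (act h) r \<or> u = rot (map (act h) r)"
      by (metis length_map rot_rot)
  next
    assume "u = map (act h) r \<or> u = rot (map (act h) r)"
    then show "default_S u" unfolding default_S_def u r_def using h(1) by blast
  qed
  then show ?thesis using that[of "map (act h) r"] rl h(2) by simp
qed

end

section \<open>The invariant limit structure\<close>

context good_action
begin

definition prescribed :: "'y pt \<Rightarrow> 'y pt list \<Rightarrow> bool" where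
  "prescribed x l \<longleftrightarrow> map (\<lambda>y. if y = x then None else Some y) l \<in> set (rels x)"

text \<open>By \<open>rank_below\<close> at most one of two points lists the other, so the two
  prescriptions never compete.\<close>

definition arc :: "'y pt \<Rightarrow> 'y pt \<Rightarrow> bool" where
  "arc x y \<longleftrightarrow> (if y \<in> set (below x) then prescribed x [x, y]
     else if x \<in> set (below y) then prescribed y [x, y] else default_R x y)"

definition cone :: "'y pt \<Rightarrow> 'y pt set" where
  "cone x = insert x (set (below x))"

text \<open>Two different entries cannot both have all entries in their cones, again by rank, so at
  most one prescription governs a tuple.\<close>

definition quad :: "'y pt list \<Rightarrow> bool" where
  "quad t \<longleftrightarrow> distinct t \<and> (if \<exists>x\<in>set t. set t \<subseteq> cone x
     then \<exists>x\<in>set t. set t \<subseteq> cone x \<and> prescribed x t else default_S t)"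

definition pre_limit :: "'y pt lstr" where
  "pre_limit = \<lparr>carrier = UNIV, relR = {(x, y). arc x y}, relS = {(a, b, c, d). quad [a, b, c, d]}\<rparr>"

lemma pre_limit_simps [simp]:
  "carrier pre_limit = UNIV" "(x, y) \<in> relR pre_limit \<longleftrightarrow> arc x y"
  "(x, y, z, w) \<in> relS pre_limit \<longleftrightarrow> quad [x, y, z, w]"
  by (simp_all add: pre_limit_def)

text \<open>Prescriptions are arbitrary lists and may violate the axioms; only terms with an
  admissible cone are kept. Since the relations are already defined on all terms, no simultaneous
  recursion is needed.\<close>

inductive_set Omega :: "'y pt set" where
  OmegaI: "set_pt x \<subseteq> Y \<Longrightarrow> (\<forall>y\<in>set (below x). y \<in> Omega) \<Longrightarrow> D_structure (substr pre_limit (cone x)) \<Longrightarrow> x \<in> Omega"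

definition limit :: "'y pt lstr" where
  "limit = substr pre_limit Omega"

lemma Omega_pts: "x \<in> Omega \<Longrightarrow> x \<in> pts"
  by (auto simp: pts_def elim: Omega.cases)

lemma Omega_cone: "x \<in> Omega \<Longrightarrow> D_structure (substr pre_limit (cone x))"
  by (auto elim: Omega.cases)

text \<open>Numbering the leaves maps \<open>Omega\<close> injectively into the countable type of
  terms over \<open>nat\<close>.\<close>

lemma countable_Omega: "countable Omega"
proof (rule countableI')
  let ?f = "map_pt (to_nat_on Y)"
  show "inj_on (to_nat \<circ> ?f) Omega"
  proof (rule inj_onI)
    fix x y assume "x \<in> Omega" "y \<in> Omega" and "(to_nat \<circ> ?f) x = (to_nat \<circ> ?f) y"
    then have "set_pt x \<subseteq> Y" "set_pt y \<subseteq> Y" "?f x = ?f y" using Omega_pts by (auto simp: pts_def)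
    moreover have "inj_on (to_nat_on Y) Y" using countable_Y by (rule inj_on_to_nat_on)
    ultimately show "x = y"
      by (intro pt.inj_map_strong[of x y "to_nat_on Y" "to_nat_on Y"]) (auto dest: inj_onD)
  qed
qed

section \<open>Invariance of the relations and of the domain\<close>

text \<open>Renaming by \<open>g\<close> is injective on \<open>pts\<close> and leaves
  \<open>None\<close> alone, so it neither creates nor destroys prescriptions.\<close>

lemma prescribed_act:
  assumes g: "g \<in> G" and x: "x \<in> pts" and l: "set l \<subseteq> pts"
  shows "prescribed (act g x) (map (act g) l) \<longleftrightarrow> prescribed x l"
proof -
  let ?P = "insert None (Some ` pts)"
  have "inj_on (map_option (act g)) ?P"
    using act_eq_iff[OF g] by (auto simp: inj_on_def)
  then have inj: "inj_on (map (map_option (act g))) (lists ?P)"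
    by (intro inj_on_mapI) (erule inj_on_subset, auto)
  let ?m = "map (\<lambda>y. if y = x then None else Some y) l"
  have "set (rels x) \<subseteq> lists ?P"
  proof
    fix k assume k: "k \<in> set (rels x)"
    have "o' \<in> ?P" if "o' \<in> set k" for o'
      using set_pt_rels[OF k] that x by (cases o') (auto simp: pts_def)
    then show "k \<in> lists ?P" by auto
  qed
  moreover have "?m \<in> lists ?P" using l by (auto simp: subset_iff)
  ultimately have "map (map_option (act g)) ?m \<in> map (map_option (act g)) ` set (rels x) \<longleftrightarrow> ?m \<in> set (rels x)"
    by (intro inj_on_image_mem_iff[OF inj]) auto
  moreover have "map (map_option (act g)) ?m = map (\<lambda>y. if y = act g x then None else Some y) (map (act g) l)"
    using l x act_eq_iff[OF g] by auto
  ultimately show ?thesis by (simp only: prescribed_def rels_map set_map)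
qed

lemma below_act:
  assumes "g \<in> G" "x \<in> pts" "y \<in> pts"
  shows "act g y \<in> set (below (act g x)) \<longleftrightarrow> y \<in> set (below x)"
proof -
  have "inj_on (act g) pts" using act_eq_iff[OF assms(1)] by (auto simp: inj_on_def)
  then show ?thesis using inj_on_image_mem_iff[of "act g" pts y "set (below x)"] below_pts[OF assms(2)] assms(3)
    by simp
qed

lemma cone_act: "cone (act g x) = act g ` cone x"
  by (simp add: cone_def)

lemma cone_pts: "x \<in> pts \<Longrightarrow> cone x \<subseteq> pts"
  using below_pts by (simp add: cone_def)

lemma arc_act:
  assumes "g \<in> G" "x \<in> pts" "y \<in> pts"
  shows "arc (act g x) (act g y) \<longleftrightarrow> arc x y"
  using below_act[OF assms] below_act[OF assms(1,3,2)] assms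
    prescribed_act[OF assms(1,2), of "[x, y]"] prescribed_act[OF assms(1,3), of "[x, y]"]
    pair_orbit_act[OF assms] pair_orbit_act[OF assms(1,3,2)]
  by (simp add: arc_def default_R_def)

lemma quad_act:
  assumes g: "g \<in> G" and t: "set t \<subseteq> pts"
  shows "quad (map (act g) t) \<longleftrightarrow> quad t"
proof -
  have inj: "inj_on (act g) pts" using act_eq_iff[OF g] by (auto simp: inj_on_def)
  then have "inj_on (act g) (set t)" using t inj_on_subset by blast
  then have 1: "distinct (map (act g) t) \<longleftrightarrow> distinct t" by (simp add: distinct_map)
  have 2: "act g ` set t \<subseteq> cone (act g x) \<longleftrightarrow> set t \<subseteq> cone x" if "x \<in> set t" for x
  proof -
    have "act g y \<in> act g ` cone x \<longleftrightarrow> y \<in> cone x" if "y \<in> set t" for y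
      using inj_on_image_mem_iff[OF inj, of y "cone x"] cone_pts \<open>x \<in> set t\<close> that t by blast
    then show ?thesis unfolding cone_act by (auto simp: subset_iff)
  qed
  have 3: "prescribed (act g x) (map (act g) t) \<longleftrightarrow> prescribed x t" if "x \<in> set t" for x
    using prescribed_act[OF g _ t] that t by blast
  show ?thesis
    unfolding quad_def 1 default_S_act[OF g t] set_map bex_simps(7)
    by (simp add: 2 3 cong: bex_cong_simp)
qed

lemma act_embedding:
  assumes "g \<in> G" "X \<subseteq> pts"
  shows "embedding (substr pre_limit X) pre_limit (act g)"
  unfolding embedding_def
proof (intro conjI ballI)
  show "inj_on (act g) (carrier (substr pre_limit X))"
    using assms(2) by (auto intro!: inj_onI simp: act_eq_iff[OF assms(1)] subset_iff)
next
  fix x y assume "x \<in> carrier (substr pre_limit X)" "y \<in> carrier (substr pre_limit X)"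
  then show "((x, y) \<in> relR (substr pre_limit X)) = ((act g x, act g y) \<in> relR pre_limit)"
    using arc_act[OF assms(1), of x y] assms(2) by auto
next
  fix x y z w assume "x \<in> carrier (substr pre_limit X)" "y \<in> carrier (substr pre_limit X)"
    "z \<in> carrier (substr pre_limit X)" "w \<in> carrier (substr pre_limit X)"
  then show "((x, y, z, w) \<in> relS (substr pre_limit X)) = ((act g x, act g y, act g z, act g w) \<in> relS pre_limit)"
    using quad_act[OF assms(1), of "[x, y, z, w]"] assms(2) by auto
qed simp

text \<open>An inverse of \<open>g\<close> embeds the cone of \<open>act g x\<close> into the cone
  of \<open>x\<close>, and the axioms pull back along embeddings.\<close>

lemma act_Omega: "x \<in> Omega \<Longrightarrow> g \<in> G \<Longrightarrow> act g x \<in> Omega"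
proof (induction x rule: Omega.induct)
  case (OmegaI x)
  then have x: "x \<in> pts" by (simp add: pts_def)
  obtain h where h: "h \<in> G" "\<And>x. x \<in> pts \<Longrightarrow> act h (act g x) = x"
    using act_inverse[OF OmegaI.prems] by metis
  have gx: "cone (act g x) \<subseteq> pts" using x OmegaI.prems act_pts cone_pts by blast
  have "act h ` cone (act g x) \<subseteq> cone x" using h(2) x cone_pts[OF x] unfolding cone_act by force
  then have "embedding (substr pre_limit (cone (act g x))) (substr pre_limit (cone x)) (act h)"
    using act_embedding[OF h(1) gx] by (auto simp: embedding_def)
  then have "D_structure (substr pre_limit (cone (act g x)))"
    using D_structure_embedding[OF lstructure_substr _ \<open>D_structure (substr pre_limit (cone x))\<close>] by blast
  moreover have "set_pt (act g x) \<subseteq> Y" using act_pts[OF OmegaI.prems x] by (simp add: pts_def)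
  ultimately show ?case using OmegaI by (intro Omega.OmegaI) auto
qed

section \<open>Exclusion of independent triples\<close>

lemma not_below_self: "x \<notin> set (below x)"
  using rank_below by blast

lemma arc_irrefl: "\<not> arc x x"
  by (simp add: arc_def default_R_def not_below_self)

lemma arc_cone_asym:
  assumes "x \<in> Omega" "y \<in> cone x" "z \<in> cone x" "arc y z"
  shows "\<not> arc z y"
  using Omega_cone[OF assms(1)] assms(2-) unfolding D_structure_def I3_free_oriented_graph_def
  by (auto simp: asym_iff)

lemma arc_asym:
  assumes "x \<in> Omega" "y \<in> Omega" "arc x y"
  shows "\<not> arc y x"
proof (cases "x \<in> set (below y) \<or> y \<in> set (below x)")
  case True
  then show ?thesis
    using arc_cone_asym[OF assms(1), of x y] arc_cone_asym[OF assms(2), of x y] assms(3) by (auto simp: cone_def)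
next
  case False
  then show ?thesis using assms(3) default_R_asym by (simp add: arc_def)
qed

definition independent :: "'y pt \<Rightarrow> 'y pt \<Rightarrow> bool" where
  "independent x y \<longleftrightarrow> x \<noteq> y \<and> x \<in> Omega \<and> y \<in> Omega \<and> \<not> arc x y \<and> \<not> arc y x"

definition linked :: "'y pt \<Rightarrow> 'y pt \<Rightarrow> bool" where
  "linked x y \<longleftrightarrow> x \<in> set (below y) \<or> y \<in> set (below x)"

lemma independent_sym: "independent x y \<Longrightarrow> independent y x"
  by (auto simp: independent_def)

lemma linked_sym: "linked x y \<Longrightarrow> linked y x"
  by (auto simp: linked_def)

lemma linked_rank: "linked x y \<Longrightarrow> rank x \<noteq> rank y"
  by (auto simp: linked_def dest: rank_below)

text \<open>No prescription concerns an unlinked pair, and the default leaves out an arc only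
  between exchanged points.\<close>

lemma independent_not_linked: "independent x y \<Longrightarrow> \<not> linked x y \<Longrightarrow> swappable x y"
  by (auto simp: independent_def linked_def arc_def intro: default_R_total)

lemma cone_no_independent_triple:
  assumes i: "independent x y" "independent x z" "independent y z"
    and b: "y \<in> set (below x)" "z \<in> set (below x)"
  shows False
proof -
  have "card {x, y, z} = 3" using i by (auto simp: independent_def)
  moreover have "{x, y, z} \<subseteq> cone x" using b by (auto simp: cone_def)
  ultimately obtain u v where "u \<in> {x, y, z}" "v \<in> {x, y, z}" "arc u v"
    using Omega_cone[of x] i(1) unfolding D_structure_def I3_free_oriented_graph_def independent_def
    by (auto dest!: spec[of _ "{x, y, z}"])
  then show False using i arc_irrefl unfolding independent_def by blast
qed

text \<open>If \<open>z\<close> lists one of \<open>x\<close>, \<open>y\<close>, equality of their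
  ranks makes it list both, and its cone contains the triple. If both list \<open>z\<close>, then
  \<open>z\<close> and its image under the exchanging element both lie in the cone of
  \<open>y\<close> and form an independent triple with \<open>y\<close>, unless \<open>z\<close> is
  fixed.\<close>

lemma no_independent_swapped_pair_linked:
  assumes i: "independent x y" "independent x z" "independent y z"
    and s: "swappable x y" and l: "linked x z" "linked y z"
  shows False
proof (cases "x \<in> set (below z) \<or> y \<in> set (below z)")
  case True
  then have "x \<in> set (below z) \<and> y \<in> set (below z)"
    using l swappable_rank[OF s] rank_below unfolding linked_def by (metis less_asym)
  then show False using cone_no_independent_triple[of z x y] i independent_sym by blast
next
  case False
  then have zb: "z \<in> set (below x)" "z \<in> set (below y)" using l by (auto simp: linked_def)
  obtain g where g: "g \<in> G" "act g x = y" "act g y = x" using s by (auto simp: swappable_def)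
  have Omega: "x \<in> Omega" "y \<in> Omega" "z \<in> Omega" using i by (auto simp: independent_def)
  note pts = Omega[THEN Omega_pts]
  have gz: "act g z \<in> set (below y)" "act g z \<in> Omega"
    using zb(1) g(2) below_map[of g x] Omega(3) act_Omega g(1) by auto
  have "act g (act g x) = x" using g by simp
  \<comment> \<open>The square of \<open>g\<close> fixes every leaf of \<open>x\<close>, and the
    leaves of \<open>z\<close> are among them.\<close>
  then have "act g (act g z) = z"
    using set_pt_below[OF zb(1)] unfolding act2_eq_self by blast
  show False
  proof (cases "act g z = z")
    case True
    \<comment> \<open>A fixed \<open>z\<close> has a fixed base, which forbids \<open>g\<close> to
      move \<open>x\<close> in an orbit of length two.\<close>
    then have "g (base z) = base z" using base_map[of g z] by simp
    then have "act g x = x"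
      using act_no_fixed_point[of g "base z" x] base_Y[of z] pts g(1) \<open>act g (act g x) = x\<close> by blast
    then show False using g(2) i(1) by (simp add: independent_def)
  next
    case False
    \<comment> \<open>\<open>g\<close> exchanges \<open>z\<close> and \<open>act g z\<close>, so an
      arc in one direction would yield the opposite arc.\<close>
    have "\<not> arc z (act g z)"
      using arc_act[OF g(1), of z "act g z"] arc_asym[of z "act g z"] \<open>act g (act g z) = z\<close> Omega gz pts act_pts g(1)
      by auto
    moreover have "\<not> arc (act g z) z"
      using arc_act[OF g(1), of "act g z" z] arc_asym[of "act g z" z] \<open>act g (act g z) = z\<close> Omega gz pts act_pts g(1)
      by auto
    moreover have "\<not> arc y (act g z)" "\<not> arc (act g z) y"
      using arc_act[OF g(1), of x z] arc_act[OF g(1), of z x] g(2) i(2) pts by (auto simp: independent_def)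
    ultimately have "independent y (act g z)" "independent z (act g z)"
      using Omega gz False not_below_self[of y] by (auto simp: independent_def)
    with cone_no_independent_triple[of y z "act g z"] i zb gz show False by blast
  qed
qed

text \<open>Linked points differ in rank, while unlinked independent points are exchanged and have
  equal rank. Three linked pairs put the triple into one cone, none gives a triangle of exchanges,
  exactly one contradicts the ranks, and two leave an exchanged pair linked to a third
  point.\<close>

lemma no_independent_triple:
  assumes i: "independent x y" "independent x z" "independent y z"
  shows False
proof -
  have one: False if "independent a b" "independent b c" "independent a c"
    "\<not> linked a b" "\<not> linked b c" "linked a c" for a b c
    using that swappable_rank[OF independent_not_linked] linked_rank by metis
  note i' = i i[THEN independent_sym]
  consider "linked x y" "linked x z" "linked y z" | "\<not> linked x y" "\<not> linked x z" "\<not> linked y z"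
    | "linked x y" "linked x z" "\<not> linked y z" | "linked x y" "\<not> linked x z" "linked y z"
    | "\<not> linked x y" "linked x z" "linked y z" | "\<not> linked x y" "\<not> linked x z" "linked y z"
    | "\<not> linked x y" "linked x z" "\<not> linked y z" | "linked x y" "\<not> linked x z" "\<not> linked y z"
    by blast
  then show False
  proof cases
    case 1
    show False
    proof (rule ccontr)
      have r: "u \<notin> set (below v) \<or> rank u < rank v" for u v using rank_below by blast
      \<comment> \<open>The point of largest rank lists the other two.\<close>
      have "y \<in> set (below x) \<and> z \<in> set (below x) \<or> x \<in> set (below y) \<and> z \<in> set (below y) \<or>
          x \<in> set (below z) \<and> y \<in> set (below z)"
        using 1 r[of x y] r[of y x] r[of x z] r[of z x] r[of y z] r[of z y] unfolding linked_def by linarith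
      then show False
        using cone_no_independent_triple[of x y z] cone_no_independent_triple[of y x z]
          cone_no_independent_triple[of z x y] i' by blast
    qed
  next
    case 2
    then show False
      using act_no_swap_triangle[of x y z] independent_not_linked i Omega_pts by (auto simp: independent_def)
  next
    case 3
    then show False using no_independent_swapped_pair_linked[of y z x] independent_not_linked linked_sym i' by blast
  next
    case 4
    then show False using no_independent_swapped_pair_linked[of x z y] independent_not_linked linked_sym i' by blast
  next
    case 5
    then show False using no_independent_swapped_pair_linked[of x y z] independent_not_linked linked_sym i' by blast
  next
    case 6
    then show False using one[of y x z] linked_sym i' by blast
  next
    case 7
    then show False using one[of x y z] linked_sym i' by blast
  next
    case 8
    then show False using one[of x z y] linked_sym i' by blast
  qed
qed

section \<open>The axioms of the class for the constructed structure\<close>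

lemma limit_simps [simp]:
  "carrier limit = Omega" "(x, y) \<in> relR limit \<longleftrightarrow> x \<in> Omega \<and> y \<in> Omega \<and> arc x y"
  "(x, y, z, w) \<in> relS limit \<longleftrightarrow> x \<in> Omega \<and> y \<in> Omega \<and> z \<in> Omega \<and> w \<in> Omega \<and> quad [x, y, z, w]"
  by (auto simp: limit_def)

lemma lstructure_limit: "lstructure limit"
  by (simp add: limit_def)

lemma limit_I3_free: "I3_free_oriented_graph Omega (relR limit)"
  unfolding I3_free_oriented_graph_def
proof (intro conjI allI impI)
  show "relR limit \<subseteq> Omega \<times> Omega" by auto
  show "irrefl (relR limit)" by (auto simp: irrefl_def arc_irrefl)
  show "asym (relR limit)" by (auto simp: asym_iff dest: arc_asym)
next
  fix B assume B: "B \<subseteq> Omega \<and> card B = 3"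
  then obtain x y z where xyz: "B = {x, y, z}" "x \<noteq> y" "x \<noteq> z" "y \<noteq> z"
    by (auto simp: card_3_iff)
  show "\<exists>u\<in>B. \<exists>v\<in>B. (u, v) \<in> relR limit"
  proof (rule ccontr)
    assume "\<not> (\<exists>u\<in>B. \<exists>v\<in>B. (u, v) \<in> relR limit)"
    then have "independent x y" "independent x z" "independent y z"
      using B xyz by (auto simp: independent_def)
    then show False by (rule no_independent_triple)
  qed
qed

lemma limit_semifinal: "semifinal Omega (relS limit)"
  unfolding semifinal_def
proof (intro conjI allI impI)
  show "relS limit \<subseteq> Omega \<times> Omega \<times> Omega \<times> Omega" by auto
next
  fix a b c d assume "(a, b, c, d) \<in> relS limit"
  then show "distinct [a, b, c, d]" by (simp add: quad_def)
next
  fix B assume B: "B \<subseteq> Omega \<and> card B = 4"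
  show "\<exists>b0 b1 b2 b3. B = {b0, b1, b2, b3} \<and>
           relS limit \<inter> B \<times> B \<times> B \<times> B = {(b0, b1, b2, b3), (b2, b3, b0, b1)}"
  proof (cases "\<exists>x\<in>B. B \<subseteq> cone x")
    case True
    then obtain x where x: "x \<in> B" "B \<subseteq> cone x" by blast
    then have "semifinal (cone x) (relS (substr pre_limit (cone x)))"
      using Omega_cone[of x] B by (auto simp: D_structure_def)
    then have "\<exists>b0 b1 b2 b3. B = {b0, b1, b2, b3} \<and>
        relS (substr pre_limit (cone x)) \<inter> B \<times> B \<times> B \<times> B = {(b0, b1, b2, b3), (b2, b3, b0, b1)}"
      unfolding semifinal_def using x(2) B by blast
    moreover have "relS (substr pre_limit (cone x)) \<inter> B \<times> B \<times> B \<times> B = relS limit \<inter> B \<times> B \<times> B \<times> B"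
      using x(2) B by auto
    ultimately show ?thesis by (simp only:)
  next
    case False
    obtain t where t: "length t = 4" "set t = B" "\<And>u. set u = B \<Longrightarrow> default_S u \<longleftrightarrow> u = t \<or> u = rot t"
      using default_S_semifinal[of B] B Omega_pts by blast
    then obtain b0 b1 b2 b3 where b: "t = [b0, b1, b2, b3]"
      by (auto simp: numeral_eq_Suc length_Suc_conv)
    have Beq: "B = {b0, b1, b2, b3}" using t(2) b by auto
    have quad: "quad [x, y, z, w] \<longleftrightarrow> (x, y, z, w) \<in> {(b0, b1, b2, b3), (b2, b3, b0, b1)}"
      if "x \<in> B" "y \<in> B" "z \<in> B" "w \<in> B" for x y z w
    proof (cases "distinct [x, y, z, w]")
      case True
      have fin: "finite B" using B by (intro card_ge_0_finite) simp
      have "card (set [x, y, z, w]) = card B" using distinct_card[OF True] B by simp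
      moreover have "set [x, y, z, w] \<subseteq> B" using that by simp
      ultimately have eq: "set [x, y, z, w] = B" using fin by (intro card_subset_eq)
      have "quad [x, y, z, w] \<longleftrightarrow> default_S [x, y, z, w]"
        unfolding quad_def eq using True False by simp
      also have "\<dots> \<longleftrightarrow> [x, y, z, w] = t \<or> [x, y, z, w] = rot t" by (rule t(3)[OF eq])
      finally show ?thesis by (simp add: b)
    next
      case False
      have "distinct t" using t(1,2) B by (simp add: card_distinct)
      with False show ?thesis by (auto simp: quad_def b)
    qed
    have "relS limit \<inter> B \<times> B \<times> B \<times> B = {(b0, b1, b2, b3), (b2, b3, b0, b1)}"
    proof (intro equalityI subsetI)
      fix p assume p: "p \<in> relS limit \<inter> B \<times> B \<times> B \<times> B"
      obtain x y z w where xyzw: "p = (x, y, z, w)" by (cases p)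
      with p have "x \<in> B" "y \<in> B" "z \<in> B" "w \<in> B" "quad [x, y, z, w]" by simp_all
      with quad show "p \<in> {(b0, b1, b2, b3), (b2, b3, b0, b1)}" unfolding xyzw by blast
    next
      fix p assume p: "p \<in> {(b0, b1, b2, b3), (b2, b3, b0, b1)}"
      have bB: "b0 \<in> B" "b1 \<in> B" "b2 \<in> B" "b3 \<in> B" using Beq by auto
      moreover have "b0 \<in> Omega" "b1 \<in> Omega" "b2 \<in> Omega" "b3 \<in> Omega" using bB B by auto
      ultimately show "p \<in> relS limit \<inter> B \<times> B \<times> B \<times> B"
        using p quad[OF bB] quad[OF bB(3,4,1,2)] by (elim insertE emptyE) simp_all
    qed
    with Beq show ?thesis by blast
  qed
qed

lemma D_structure_limit: "D_structure limit"
  using limit_I3_free limit_semifinal by (simp add: D_structure_def)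

end

section \<open>Extension property and identification with the Fraisse limit\<close>

lemma embedding_inverse:
  assumes "embedding (substr N X) N' f" "X \<subseteq> carrier N"
  shows "embedding (substr N' (f ` X)) N (inv_into X f)"
proof -
  have "inj_on f X" using assms(1) by (simp add: embedding_def)
  then have [simp]: "inv_into X f (f a) = a" if "a \<in> X" for a using that by simp
  show ?thesis
    using assms unfolding embedding_def by (simp add: inj_on_inv_into image_subset_iff subset_iff)
qed

lemma singleton_D_structure:
  assumes "lstructure N" "carrier N = {x}" "(x, x) \<notin> relR N" "(x, x, x, x) \<notin> relS N"
  shows "D_structure N"
proof -
  have "relR N = {}" "relS N = {}" using assms by (auto simp: lstructure_def)
  moreover have "\<not> (B \<subseteq> {x} \<and> card B = n)" if "n > 1" for B n
    using card_mono[of "{x}" B] that by auto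
  then have "\<not> (B \<subseteq> {x} \<and> card B = 3)" "\<not> (B \<subseteq> {x} \<and> card B = 4)" for B by simp_all
  ultimately show ?thesis
    using assms(2) by (simp add: D_structure_def I3_free_oriented_graph_def semifinal_def irrefl_def asym_iff)
qed

context good_action
begin

text \<open>Such a point prescribes nothing and moves exactly as \<open>y\<close> does; the
  faithfulness of the action is read off from these points.\<close>

lemma Pt_Nil_Omega: "y \<in> Y \<Longrightarrow> Pt y [] [] \<in> Omega"
proof (rule OmegaI)
  show "D_structure (substr pre_limit (cone (Pt y [] [])))"
    by (rule singleton_D_structure[of _ "Pt y [] []"]) (simp_all add: cone_def arc_irrefl quad_def)
qed auto

text \<open>The required point is written down as a term: it lists the image of the old domain and
  prescribes the relations found in \<open>K\<close>.\<close>

lemma limit_extension: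
  assumes K: "D_structure K" and P: "partial_iso K limit P" "finite P" and x: "x \<in> carrier K"
  shows "\<exists>y. partial_iso K limit (insert (x, y) P)"
proof (cases "x \<in> fst ` P")
  case True
  then obtain y where "(x, y) \<in> P" by auto
  then have "insert (x, y) P = P" by (rule insert_absorb)
  with P(1) show ?thesis by (intro exI[of _ y]) simp
next
  case False
  define X where "X = fst ` P"
  define X' where "X' = insert x X"
  obtain f where f: "P = (\<lambda>a. (a, f a)) ` X" "embedding (substr K X) limit f"
    using partial_iso_function[OF P(1)] unfolding X_def .
  have X: "finite X" "X \<subseteq> carrier K" "x \<notin> X" using P False by (auto simp: X_def partial_iso_def)
  have X': "X' \<subseteq> carrier K" "finite X'" using X x by (auto simp: X'_def)
  have fOm: "\<And>u. u \<in> X \<Longrightarrow> f u \<in> Omega" and finj: "inj_on f X"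
    using f(2) by (auto simp: embedding_def)
  have fR: "arc (f u) (f v) \<longleftrightarrow> (u, v) \<in> relR K" if "u \<in> X" "v \<in> X" for u v
    using f(2) that fOm unfolding embedding_def by simp
  have fS: "quad [f u, f v, f w, f z] \<longleftrightarrow> (u, v, w, z) \<in> relS K"
    if "u \<in> X" "v \<in> X" "w \<in> X" "z \<in> X" for u v w z
    using f(2) that fOm unfolding embedding_def by simp
  obtain fs where fs: "set fs = f ` X" using finite_list[OF finite_imageI[OF X(1)]] ..
  \<comment> \<open>Any base serves: the relations of the new point to the old domain are all
    prescribed.\<close>
  obtain b where b: "b \<in> Y" using Y_nonempty by blast
  define q where "q u = (if u = x then None else Some (f u))" for u
  define rl where "rl = (\<lambda>(u, v). [q u, q v]) ` (relR K \<inter> X' \<times> X') \<union>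
    (\<lambda>(u, v, w, z). [q u, q v, q w, q z]) ` (relS K \<inter> X' \<times> X' \<times> X' \<times> X')"
  have "finite rl" unfolding rl_def using X' by (intro finite_UnI finite_imageI finite_Int) auto
  from finite_list[OF this] obtain rs where rs: "set rs = rl" ..
  define y where "y = Pt b fs rs"
  define f' where "f' = f(x := y)"
  have qinj: "q u = q v \<longleftrightarrow> u = v" if "u \<in> X'" "v \<in> X'" for u v
    using that X(3) finj by (auto simp: q_def X'_def inj_on_eq_iff)
  have rl2: "[q u, q v] \<in> rl \<longleftrightarrow> (u, v) \<in> relR K" if "u \<in> X'" "v \<in> X'" for u v
  proof
    assume "[q u, q v] \<in> rl"
    then obtain u' v' where "(u', v') \<in> relR K" "u' \<in> X'" "v' \<in> X'" "[q u, q v] = [q u', q v']"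
      unfolding rl_def by auto
    then show "(u, v) \<in> relR K" using qinj that by simp
  next
    assume "(u, v) \<in> relR K"
    then show "[q u, q v] \<in> rl"
      unfolding rl_def using that by (intro UnI1 image_eqI[of _ _ "(u, v)"]) simp_all
  qed
  have rl4: "[q u, q v, q w, q z] \<in> rl \<longleftrightarrow> (u, v, w, z) \<in> relS K"
    if "u \<in> X'" "v \<in> X'" "w \<in> X'" "z \<in> X'" for u v w z
  proof
    assume "[q u, q v, q w, q z] \<in> rl"
    then obtain u' v' w' z' where "(u', v', w', z') \<in> relS K" "u' \<in> X'" "v' \<in> X'" "w' \<in> X'" "z' \<in> X'"
      "[q u, q v, q w, q z] = [q u', q v', q w', q z']"
      unfolding rl_def by auto
    then show "(u, v, w, z) \<in> relS K" using qinj that by simp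
  next
    assume "(u, v, w, z) \<in> relS K"
    then show "[q u, q v, q w, q z] \<in> rl"
      unfolding rl_def using that by (intro UnI2 image_eqI[of _ _ "(u, v, w, z)"]) simp_all
  qed
  have yb: "set (below y) = f ` X" by (simp add: y_def fs)
  \<comment> \<open>Freshness is automatic, because the listed terms have smaller rank than
    \<open>y\<close>.\<close>
  have rank: "rank (f u) < rank y" if "u \<in> X" for u using that yb by (intro rank_below) simp
  then have fy: "f u \<noteq> y" if "u \<in> X" for u using that by blast
  have ynb: "y \<notin> cone (f u)" if "u \<in> X" for u
    using rank[OF that] rank_below[of y "f u"] by (auto simp: cone_def)
  have f'x: "f' x = y" and f'X: "\<And>u. u \<in> X \<Longrightarrow> f' u = f u" using X(3) by (auto simp: f'_def)
  have pr: "prescribed y (map f' us) \<longleftrightarrow> map q us \<in> rl" if "set us \<subseteq> X'" for us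
  proof -
    have "map ((\<lambda>v. if v = y then None else Some v) \<circ> f') us = map q us"
      using that f'x f'X fy X(3) by (intro map_cong refl) (auto simp: q_def X'_def)
    moreover have "rels y = rs" by (simp add: y_def)
    ultimately show ?thesis by (simp only: prescribed_def map_map rs)
  qed
  have f'inj: "inj_on f' X'"
    using finj fy X(3) by (auto simp: f'_def X'_def inj_on_def)
  have irr: "(x, x) \<notin> relR K"
    using K by (auto simp: D_structure_def I3_free_oriented_graph_def irrefl_def)
  have R': "arc (f' u) (f' v) \<longleftrightarrow> (u, v) \<in> relR K" if uv: "u \<in> X'" "v \<in> X'" for u v
  proof -
    have pr2: "prescribed y [f' u, f' v] \<longleftrightarrow> (u, v) \<in> relR K"
      using pr[of "[u, v]"] rl2[OF uv] uv by simp
    consider "u \<in> X" "v \<in> X" | "u = x" "v = x" | "u = x" "v \<in> X" | "u \<in> X" "v = x"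
      using uv by (auto simp: X'_def)
    then show ?thesis
    proof cases
      case 1 then show ?thesis using fR f'X by simp
    next
      case 2 then show ?thesis using irr arc_irrefl by simp
    next
      case 3
      then show ?thesis using pr2 f'x f'X yb by (simp add: arc_def)
    next
      case 4
      then show ?thesis using pr2 f'x f'X yb ynb[of u] by (simp add: arc_def cone_def)
    qed
  qed
  have dis: "distinct [u, v, w, z]" if "(u, v, w, z) \<in> relS K" for u v w z
    using K that unfolding D_structure_def semifinal_def by blast
  have S': "quad [f' u, f' v, f' w, f' z] \<longleftrightarrow> (u, v, w, z) \<in> relS K"
    if uvwz: "u \<in> X'" "v \<in> X'" "w \<in> X'" "z \<in> X'" for u v w z
  proof (cases "x \<in> {u, v, w, z}")
    case False
    then show ?thesis using uvwz fS f'X by (auto simp: X'_def)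
  next
    case True
    let ?t = "map f' [u, v, w, z]"
    have t: "y \<in> set ?t" "set ?t \<subseteq> cone y"
      using True uvwz f'x f'X yb by (auto simp: cone_def X'_def)
    \<comment> \<open>The tuple contains \<open>y\<close>, which lies in no cone of an old point;
      hence the prescription of \<open>y\<close> decides.\<close>
    have only: "p = y" if "p \<in> set ?t" "set ?t \<subseteq> cone p" for p
    proof (rule ccontr)
      assume "p \<noteq> y"
      then have "p \<in> f ` X" using that(1) t(2) yb by (auto simp: cone_def)
      then show False using ynb that(2) t(1) by blast
    qed
    have "quad ?t \<longleftrightarrow> distinct ?t \<and> prescribed y ?t"
      unfolding quad_def using t only by metis
    also have "prescribed y ?t \<longleftrightarrow> (u, v, w, z) \<in> relS K"
      using pr[of "[u, v, w, z]"] rl4[OF uvwz] uvwz by simp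
    also have "distinct ?t \<longleftrightarrow> distinct [u, v, w, z]"
      using f'inj uvwz by (simp add: inj_on_eq_iff)
    finally show ?thesis using dis by auto
  qed
  have emb: "embedding (substr K X') pre_limit f'"
    unfolding embedding_def using f'inj R' S' by simp
  have "y \<in> Omega"
  proof (rule OmegaI)
    have leaves: "\<Union> (set_pt ` f ` X) \<subseteq> Y" using Omega_pts[OF fOm] by (auto simp: pts_def)
    have "\<Union> (set_pt ` set_option p) \<subseteq> Y" if "l \<in> rl" "p \<in> set l" for l p
    proof -
      have "p \<in> q ` X'" using that by (auto simp: rl_def)
      then have "set_option p \<subseteq> f ` X" by (auto simp: q_def X'_def split: if_splits)
      then show ?thesis using leaves by blast
    qed
    then have "{b} \<union> \<Union> (set_pt ` f ` X) \<union> (\<Union>l\<in>rl. \<Union>p\<in>set l. \<Union> (set_pt ` set_option p)) \<subseteq> Y"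
      using b leaves by (intro Un_least UN_least) auto
    then show "set_pt y \<subseteq> Y" by (simp add: y_def fs rs)
    show "\<forall>z\<in>set (below y). z \<in> Omega" using yb fOm by simp
    \<comment> \<open>The cone of \<open>y\<close> is a copy of the substructure of \<open>K\<close>
      on \<open>X'\<close>, so it inherits the axioms from \<open>K\<close>.\<close>
    have "cone y = f' ` X'" using yb f'x f'X by (auto simp: cone_def X'_def)
    moreover have "D_structure (substr pre_limit (f' ` X'))"
      using embedding_inverse[OF emb X'(1)] K by (rule D_structure_embedding[OF lstructure_substr])
    ultimately show "D_structure (substr pre_limit (cone y))" by simp
  qed
  then have "f' ` X' \<subseteq> Omega" using fOm f'x f'X by (auto simp: X'_def)
  then have "embedding (substr K X') limit f'"
    using emb unfolding embedding_def by (simp add: image_subset_iff)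
  from partial_iso_graph[OF this X'(1)] have "partial_iso K limit ((\<lambda>a. (a, f' a)) ` X')" .
  moreover have "(\<lambda>a. (a, f' a)) ` X' = insert (x, y) P"
    unfolding f(1) X'_def image_insert f'x using f'X by (intro arg_cong[of _ _ "insert _"] image_cong) auto
  ultimately show ?thesis by (intro exI[of _ y]) (simp only:)
qed

lemma isomorphic_fraisse_limit:
  assumes "fraisse_limit class_D M"
  shows "isomorphic limit M"
proof (rule back_and_forth)
  show "countable (carrier M)" using assms by (simp add: fraisse_limit_def)
  show "countable (carrier limit)" using countable_Omega by simp
  show "lstructure limit" by (rule lstructure_limit)
  show "\<exists>y. partial_iso limit M (insert (x, y) P)"
    if "finite P" "partial_iso limit M P" "x \<in> carrier limit" for P x
    using fraisse_limit_extension[OF assms D_structure_limit] that by blast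
  show "\<exists>y. partial_iso M limit (insert (x, y) P)"
    if "finite P" "partial_iso M limit P" "x \<in> carrier M" for P x
    using limit_extension[OF fraisse_limit_D_structure[OF assms]] that by blast
qed

lemma act_isomorphism:
  assumes "g \<in> G"
  shows "isomorphism limit limit (act g)"
proof -
  have Omega: "Omega \<subseteq> pts" using Omega_pts by blast
  obtain h where h: "h \<in> G" "\<And>x. x \<in> pts \<Longrightarrow> act g (act h x) = x"
    using act_inverse[OF assms] by metis
  have "embedding limit limit (act g)"
    using act_embedding[OF assms Omega] act_Omega[OF _ assms]
    by (auto simp: embedding_def simp flip: limit_def)
  moreover have "act g ` Omega = Omega"
  proof
    show "act g ` Omega \<subseteq> Omega" using act_Omega assms by blast
    show "Omega \<subseteq> act g ` Omega"
    proof
      fix x assume x: "x \<in> Omega"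
      then have "x = act g (act h x)" using h(2) Omega by auto
      then show "x \<in> act g ` Omega" using act_Omega[OF x h(1)] by blast
    qed
  qed
  ultimately show ?thesis by (simp add: isomorphism_def)
qed

end

section \<open>Homomorphisms between automorphism groups\<close>

lemma isomorphism_bij_betw: "isomorphism N N' f \<Longrightarrow> bij_betw f (carrier N) (carrier N')"
  by (simp add: isomorphism_def embedding_def bij_betw_def)

lemma isomorphism_comp:
  "isomorphism N N' f \<Longrightarrow> isomorphism N' N'' g \<Longrightarrow> isomorphism N N'' (g \<circ> f)"
  unfolding isomorphism_def using embedding_comp by (metis image_comp)

lemma isomorphism_inverse:
  assumes "isomorphism N N' f"
  shows "isomorphism N' N (inv_into (carrier N) f)"
proof -
  let ?i = "inv_into (carrier N) f"
  have b: "bij_betw f (carrier N) (carrier N')" using assms by (rule isomorphism_bij_betw)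
  have i: "bij_betw ?i (carrier N') (carrier N)" using b by (rule bij_betw_inv_into)
  have fi: "f (?i y) = y" if "y \<in> carrier N'" for y using bij_betw_inv_into_right[OF b that] .
  have ic: "?i y \<in> carrier N" if "y \<in> carrier N'" for y using i that by (auto simp: bij_betw_def)
  have e: "embedding N N' f" using assms by (simp add: isomorphism_def)
  have "embedding N' N ?i"
    unfolding embedding_def
  proof (intro conjI ballI)
    fix x y assume "x \<in> carrier N'" "y \<in> carrier N'"
    then show "((x, y) \<in> relR N') = ((?i x, ?i y) \<in> relR N)"
      using e ic[of x] ic[of y] fi[of x] fi[of y] unfolding embedding_def by simp
  next
    fix x y z w assume "x \<in> carrier N'" "y \<in> carrier N'" "z \<in> carrier N'" "w \<in> carrier N'"
    then show "((x, y, z, w) \<in> relS N') = ((?i x, ?i y, ?i z, ?i w) \<in> relS N)"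
      using e ic[of x] ic[of y] ic[of z] ic[of w] fi[of x] fi[of y] fi[of z] fi[of w]
      unfolding embedding_def by simp
  qed (use i in \<open>simp_all add: bij_betw_def\<close>)
  then show ?thesis using i by (simp add: isomorphism_def bij_betw_def)
qed

lemma Aut_carrier: "k \<in> carrier (Aut N) \<longleftrightarrow> k \<in> extensional (carrier N) \<and> isomorphism N N k"
  using isomorphism_bij_betw[of N N k] by (auto simp: Aut_def Bij_def)

lemma Aut_mult:
  assumes "k \<in> carrier (Aut N)" "l \<in> carrier (Aut N)"
  shows "k \<otimes>\<^bsub>Aut N\<^esub> l = compose (carrier N) k l"
  using assms by (simp add: Aut_def BijGroup_def)

lemma isomorphism_cong:
  assumes "\<And>x. x \<in> carrier N \<Longrightarrow> f x = g x"
  shows "isomorphism N N' f \<longleftrightarrow> isomorphism N N' g"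
  using assms by (simp add: isomorphism_def embedding_def cong: image_cong_simp inj_on_cong)

text \<open>Elements of \<open>Aut\<close> are extensional and are multiplied by
  \<open>compose\<close>, so it is enough to control the maps \<open>\<Phi> k\<close> on the
  carriers and to restrict them.\<close>

lemma Aut_monomorphismI:
  assumes iso: "\<And>k. k \<in> carrier (Aut N) \<Longrightarrow> isomorphism N' N' (\<Phi> k)"
    and mult: "\<And>k l y. k \<in> carrier (Aut N) \<Longrightarrow> l \<in> carrier (Aut N) \<Longrightarrow> y \<in> carrier N' \<Longrightarrow>
      \<Phi> (compose (carrier N) k l) y = \<Phi> k (\<Phi> l y)"
    and faithful: "\<And>k l x. k \<in> carrier (Aut N) \<Longrightarrow> l \<in> carrier (Aut N) \<Longrightarrow>
      (\<And>y. y \<in> carrier N' \<Longrightarrow> \<Phi> k y = \<Phi> l y) \<Longrightarrow> x \<in> carrier N \<Longrightarrow> k x = l x"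
  shows "\<exists>h. h \<in> hom (Aut N) (Aut N') \<and> inj_on h (carrier (Aut N))"
proof (intro exI conjI)
  let ?h = "\<lambda>k. restrict (\<Phi> k) (carrier N')"
  have closed: "?h k \<in> carrier (Aut N')" if "k \<in> carrier (Aut N)" for k
    using iso[OF that] isomorphism_cong[of N' "?h k" "\<Phi> k" N'] by (simp add: Aut_carrier)
  have maps: "\<Phi> k y \<in> carrier N'" if "k \<in> carrier (Aut N)" "y \<in> carrier N'" for k y
    using iso[OF that(1)] that(2) by (auto simp: isomorphism_def)
  show "?h \<in> hom (Aut N) (Aut N')"
  proof (rule homI)
    fix k l assume kl: "k \<in> carrier (Aut N)" "l \<in> carrier (Aut N)"
    show "?h (k \<otimes>\<^bsub>Aut N\<^esub> l) = ?h k \<otimes>\<^bsub>Aut N'\<^esub> ?h l"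
      unfolding Aut_mult[OF kl] Aut_mult[OF closed[OF kl(1)] closed[OF kl(2)]]
      using mult[OF kl] maps[OF kl(2)] by (auto simp: compose_def)
  qed (rule closed)
  show "inj_on ?h (carrier (Aut N))"
  proof (rule inj_onI)
    fix k l assume kl: "k \<in> carrier (Aut N)" "l \<in> carrier (Aut N)" and eq: "?h k = ?h l"
    have "\<Phi> k y = \<Phi> l y" if "y \<in> carrier N'" for y using fun_cong[OF eq, of y] that by simp
    then have "k x = l x" if "x \<in> carrier N" for x using faithful[OF kl] that by blast
    then show "k = l" using kl by (auto simp: Aut_carrier intro: extensionalityI)
  qed
qed

text \<open>Conjugation by an isomorphism.\<close>

lemma isomorphic_Aut_monomorphism:
  assumes "isomorphic N N'"
  shows "\<exists>h. h \<in> hom (Aut N) (Aut N') \<and> inj_on h (carrier (Aut N))"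
proof -
  obtain f where f: "isomorphism N N' f" using assms by (auto simp: isomorphic_def)
  let ?i = "inv_into (carrier N) f"
  have b: "bij_betw f (carrier N) (carrier N')" using f by (rule isomorphism_bij_betw)
  have i: "isomorphism N' N ?i" using f by (rule isomorphism_inverse)
  have ic: "?i y \<in> carrier N" if "y \<in> carrier N'" for y
    using isomorphism_bij_betw[OF i] that by (auto simp: bij_betw_def)
  have ifx: "?i (f x) = x" if "x \<in> carrier N" for x using bij_betw_inv_into_left[OF b that] .
  have kc: "k x \<in> carrier N" if "k \<in> carrier (Aut N)" "x \<in> carrier N" for k x
    using that by (auto simp: Aut_carrier isomorphism_def)
  show ?thesis
  proof (rule Aut_monomorphismI[where \<Phi> = "\<lambda>k. f \<circ> (k \<circ> ?i)"])
    fix k assume "k \<in> carrier (Aut N)"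
    then have "isomorphism N N k" by (simp add: Aut_carrier)
    then show "isomorphism N' N' (f \<circ> (k \<circ> ?i))"
      using i f by (intro isomorphism_comp)
  next
    fix k l y assume "k \<in> carrier (Aut N)" "l \<in> carrier (Aut N)" "y \<in> carrier N'"
    then show "(f \<circ> (compose (carrier N) k l \<circ> ?i)) y = (f \<circ> (k \<circ> ?i)) ((f \<circ> (l \<circ> ?i)) y)"
      using ic kc ifx by (simp add: compose_def)
  next
    fix k l x assume kl: "k \<in> carrier (Aut N)" "l \<in> carrier (Aut N)" and x: "x \<in> carrier N"
      and eq: "\<And>y. y \<in> carrier N' \<Longrightarrow> (f \<circ> (k \<circ> ?i)) y = (f \<circ> (l \<circ> ?i)) y"
    have "f x \<in> carrier N'" using b x by (auto simp: bij_betw_def)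
    from eq[OF this] have "f (k x) = f (l x)" using ifx[OF x] by simp
    then show "k x = l x" using b kc kl x by (meson bij_betw_def inj_onD)
  qed
qed

section \<open>The action on tuples\<close>

locale countable_D_structure =
  fixes A :: "'b lstr"
  assumes D: "D_structure A" and countable_A: "countable (carrier A)"
begin

abbreviation V :: "'b set" where "V \<equiv> carrier A"

text \<open>Unlike elements of \<open>Aut A\<close>, these maps need not be extensional, so they are
  closed under plain composition.\<close>

definition auts :: "('b \<Rightarrow> 'b) set" where
  "auts = {g. isomorphism A A g}"

lemma aut_bij: "g \<in> auts \<Longrightarrow> bij_betw g V V"
  by (simp add: auts_def isomorphism_bij_betw)

lemma aut_closed: "g \<in> auts \<Longrightarrow> x \<in> V \<Longrightarrow> g x \<in> V"
  using aut_bij by (auto simp: bij_betw_def)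

lemma aut_comp: "g \<in> auts \<Longrightarrow> h \<in> auts \<Longrightarrow> g \<circ> h \<in> auts"
  by (auto simp: auts_def intro: isomorphism_comp)

lemma aut_id: "(\<lambda>x. x) \<in> auts"
  by (simp add: auts_def isomorphism_def embedding_def)

lemma aut_inverse: "g \<in> auts \<Longrightarrow> \<exists>h\<in>auts. \<forall>x\<in>V. h (g x) = x \<and> g (h x) = x"
  using isomorphism_inverse[of A A g] aut_bij[of g]
  by (intro bexI[of _ "inv_into V g"]) (auto simp: auts_def bij_betw_inv_into_left bij_betw_inv_into_right)

section \<open>Automorphisms on small invariant subsets\<close>

text \<open>An automorphism preserving the set permutes its two tuples of \<open>S\<close>, and the
  image of one tuple determines its action. One \<open>s\<close> serves all automorphisms, which
  rules out two different nontrivial actions.\<close>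

lemma aut_four_set:
  assumes "{a, b, c, d} \<subseteq> V" "distinct [a, b, c, d]"
  shows "\<exists>s. (\<forall>x\<in>{a, b, c, d}. s x \<noteq> x \<and> s (s x) = x) \<and>
    (\<forall>g\<in>auts. g ` {a, b, c, d} \<subseteq> {a, b, c, d} \<longrightarrow>
      (\<forall>x\<in>{a, b, c, d}. g x = x) \<or> (\<forall>x\<in>{a, b, c, d}. g x = s x))"
proof -
  let ?B = "{a, b, c, d}"
  have "card ?B = 4" using assms(2) by simp
  moreover have sf: "semifinal V (relS A)" using D by (simp add: D_structure_def)
  ultimately obtain b0 b1 b2 b3 where B: "?B = {b0, b1, b2, b3}"
    and T: "relS A \<inter> ?B \<times> ?B \<times> ?B \<times> ?B = {(b0, b1, b2, b3), (b2, b3, b0, b1)}"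
    using assms(1) unfolding semifinal_def by meson
  have "card {b0, b1, b2, b3} = 4" using \<open>card ?B = 4\<close> B by simp
  then have d: "distinct [b0, b1, b2, b3]" by (auto simp: card_insert_if split: if_splits)
  define s where "s = id(b0 := b2, b1 := b3, b2 := b0, b3 := b1)"
  have s: "s b0 = b2" "s b1 = b3" "s b2 = b0" "s b3 = b1" using d by (simp_all add: s_def)
  have "(\<forall>x\<in>?B. g x = x) \<or> (\<forall>x\<in>?B. g x = s x)" if g: "g \<in> auts" "g ` ?B \<subseteq> ?B" for g
  proof -
    have "(b0, b1, b2, b3) \<in> relS A" using T by blast
    moreover have "b0 \<in> V" "b1 \<in> V" "b2 \<in> V" "b3 \<in> V" using B assms(1) by blast+
    ultimately have "(g b0, g b1, g b2, g b3) \<in> relS A"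
      using g(1) by (simp add: auts_def isomorphism_def embedding_def)
    moreover have "g b0 \<in> ?B" "g b1 \<in> ?B" "g b2 \<in> ?B" "g b3 \<in> ?B" using g(2) B by blast+
    ultimately have "(g b0, g b1, g b2, g b3) \<in> {(b0, b1, b2, b3), (b2, b3, b0, b1)}"
      unfolding T[symmetric] by (intro IntI SigmaI)
    then show ?thesis unfolding B using s by auto
  qed
  moreover have "s x \<noteq> x \<and> s (s x) = x" if "x \<in> ?B" for x
    using that d s unfolding B by auto
  ultimately show ?thesis by (intro exI[of _ s]) blast
qed

lemma aut_on_four_set:
  assumes "g \<in> auts" "{a, b, c, d} \<subseteq> V" "distinct [a, b, c, d]" "g ` {a, b, c, d} \<subseteq> {a, b, c, d}"
  shows "(\<forall>x\<in>{a, b, c, d}. g x = x) \<or> (\<forall>x\<in>{a, b, c, d}. g x \<noteq> x \<and> g (g x) = x)"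
proof -
  obtain s where s: "\<forall>x\<in>{a, b, c, d}. s x \<noteq> x \<and> s (s x) = x"
    "\<forall>g\<in>auts. g ` {a, b, c, d} \<subseteq> {a, b, c, d} \<longrightarrow>
      (\<forall>x\<in>{a, b, c, d}. g x = x) \<or> (\<forall>x\<in>{a, b, c, d}. g x = s x)"
    using aut_four_set[OF assms(2,3)] by (elim exE conjE)
  from s(2)[rule_format, OF assms(1,4)] show ?thesis
  proof
    assume *: "\<forall>x\<in>{a, b, c, d}. g x = s x"
    have "g x \<noteq> x \<and> g (g x) = x" if x: "x \<in> {a, b, c, d}" for x
    proof -
      have "g x \<in> {a, b, c, d}" using assms(4) x by blast
      then show ?thesis using bspec[OF * x] bspec[OF *, of "g x"] bspec[OF s(1) x] by metis
    qed
    then show ?thesis by blast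
  qed blast
qed

lemma aut_fixing_two:
  assumes g: "g \<in> auts" and V: "p \<in> V" "q \<in> V" "z \<in> V" and p: "p \<noteq> q" "g p = p" "g q = q" and z: "g (g z) = z"
  shows "g z = z"
proof (rule ccontr)
  assume ne: "g z \<noteq> z"
  have "z \<noteq> p" "z \<noteq> q" "g z \<noteq> p" "g z \<noteq> q" using ne p z by metis+
  then have "distinct [p, q, z, g z]" using ne p by auto
  moreover have "{p, q, z, g z} \<subseteq> V" using V g aut_closed by simp
  moreover have "g ` {p, q, z, g z} \<subseteq> {p, q, z, g z}" using p z by simp
  ultimately show False using aut_on_four_set[OF g, of p q z "g z"] p ne by blast
qed

text \<open>A fixed point and an orbit of length three fill an invariant four-element set with both
  fixed and moved points. For an orbit of length two a second fixed point is used to reach four, as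
  in \<open>aut_fixing_two\<close>.\<close>

lemma aut_fixing_one:
  assumes g: "g \<in> auts" and V: "p \<in> V" "z \<in> V" and p: "g p = p" and z: "g (g (g z)) = z"
  shows "g z = z"
proof (rule ccontr)
  assume ne: "g z \<noteq> z"
  have "z \<noteq> p" "g z \<noteq> p" "g (g z) \<noteq> p" "g (g z) \<noteq> g z" "g (g z) \<noteq> z" using ne p z by metis+
  then have "distinct [p, z, g z, g (g z)]" using ne by auto
  moreover have "{p, z, g z, g (g z)} \<subseteq> V" using V g aut_closed by simp
  moreover have "g ` {p, z, g z, g (g z)} \<subseteq> {p, z, g z, g (g z)}" using p z by simp
  ultimately show False using aut_on_four_set[OF g, of p z "g z" "g (g z)"] p ne by blast
qed

lemma aut_no_four_cycle:
  assumes g: "g \<in> auts" and V: "z \<in> V" and z: "g (g (g (g z))) = z"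
  shows "g (g z) = z"
proof (rule ccontr)
  assume ne: "g (g z) \<noteq> z"
  let ?B = "{z, g z, g (g z), g (g (g z))}"
  have "g z \<noteq> z" "g (g (g z)) \<noteq> z" "g (g z) \<noteq> g z" "g (g (g z)) \<noteq> g z" "g (g (g z)) \<noteq> g (g z)"
    using ne z by metis+
  then have "distinct [z, g z, g (g z), g (g (g z))]" using ne by auto
  moreover have "?B \<subseteq> V" using V g aut_closed by simp
  moreover have "g ` ?B \<subseteq> ?B" using z by simp
  ultimately have "(\<forall>x\<in>?B. g x = x) \<or> (\<forall>x\<in>?B. g x \<noteq> x \<and> g (g x) = x)"
    by (intro aut_on_four_set[OF g])
  then show False using ne \<open>g z \<noteq> z\<close> by blast
qed

text \<open>Otherwise the orbit of \<open>p\<close> has four points, on which \<open>g\<close> and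
  \<open>h\<close> act by two different nontrivial permutations.\<close>

lemma aut_commuting_involutions:
  assumes gh: "g \<in> auts" "h \<in> auts" and p: "p \<in> V" and inv: "g (g p) = p" "h (h p) = p" "g (h p) = h (g p)"
    and inv': "g (h (g p)) = h p" "h (h (g p)) = g p"
  shows "g p = p \<or> h p = p \<or> g p = h p"
proof (rule ccontr)
  assume ne: "\<not> ?thesis"
  let ?B = "{p, g p, h p, h (g p)}"
  have "h (g p) \<noteq> p" "h (g p) \<noteq> g p" "h (g p) \<noteq> h p"
    using ne inv inv' by metis+
  then have d: "distinct [p, g p, h p, h (g p)]" using ne by auto
  have V: "?B \<subseteq> V" using p gh aut_closed by simp
  have im: "g ` ?B \<subseteq> ?B" "h ` ?B \<subseteq> ?B" using inv inv' by simp_all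
  obtain s where s: "\<forall>k\<in>auts. k ` ?B \<subseteq> ?B \<longrightarrow> (\<forall>x\<in>?B. k x = x) \<or> (\<forall>x\<in>?B. k x = s x)"
    using aut_four_set[OF V d] by (elim exE conjE)
  show False using s[rule_format, OF gh(1) im(1)] s[rule_format, OF gh(2) im(2)] ne by auto
qed

lemma aut_swapped_not_adjacent:
  assumes "g \<in> auts" "p \<in> V" "q \<in> V" "g p = q" "g q = p"
  shows "(p, q) \<notin> relR A"
proof
  assume r: "(p, q) \<in> relR A"
  then have "(g p, g q) \<in> relR A"
    using assms(1-3) by (simp add: auts_def isomorphism_def embedding_def)
  with r assms(4,5) show False
    using D by (auto simp: D_structure_def I3_free_oriented_graph_def asym_iff)
qed

lemma aut_no_swap_triangle:
  assumes "f \<in> auts" "g \<in> auts" "h \<in> auts" "p \<in> V" "q \<in> V" "r \<in> V"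
    "f p = q" "f q = p" "g q = r" "g r = q" "h p = r" "h r = p"
  shows "p = q \<or> q = r \<or> p = r"
proof (rule ccontr)
  assume ne: "\<not> ?thesis"
  then have "card {p, q, r} = 3" by auto
  moreover have "{p, q, r} \<subseteq> V" using assms by simp
  ultimately obtain u v where "u \<in> {p, q, r}" "v \<in> {p, q, r}" "(u, v) \<in> relR A"
    using D unfolding D_structure_def I3_free_oriented_graph_def by meson
  moreover have "(p, q) \<notin> relR A" "(q, p) \<notin> relR A" "(q, r) \<notin> relR A" "(r, q) \<notin> relR A"
    "(p, r) \<notin> relR A" "(r, p) \<notin> relR A"
    using aut_swapped_not_adjacent assms by metis+
  moreover have "(u, u) \<notin> relR A" for u
    using D by (auto simp: D_structure_def I3_free_oriented_graph_def irrefl_def)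
  ultimately show False by auto
qed

text \<open>When \<open>A\<close> has fewer than four points, the lists below enumerate all of \<open>A\<close>.\<close>

definition width :: nat where
  "width = (if finite V then min 4 (card V) else 4)"

definition tuples :: "'b list set" where
  "tuples = {ys. length ys = width \<and> distinct ys \<and> set ys \<subseteq> V}"

lemma tuple_cases:
  assumes "ys \<in> tuples"
  shows "width = 4 \<or> finite V \<and> set ys = V"
proof -
  have "set ys = V" if "width \<noteq> 4"
  proof (rule card_subset_eq)
    have "card (set ys) = width" using assms by (simp add: tuples_def distinct_card)
    then show "card (set ys) = card V" "finite V"
      using that by (auto simp: width_def split: if_splits)
  qed (use assms in \<open>simp add: tuples_def\<close>)
  then show ?thesis by (metis List.finite_set)
qed

lemma tuple_containing:
  assumes "T \<subseteq> V" "finite T" "card T \<le> width"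
  shows "\<exists>ys\<in>tuples. T \<subseteq> set ys"
proof -
  obtain B where B: "finite B" "T \<subseteq> B" "B \<subseteq> V" "card B = width"
  proof (cases "finite V")
    case True
    then have "width \<le> card V" by (simp add: width_def)
    from exists_subset_between[OF assms(3) this assms(1) True] obtain B
      where "T \<subseteq> B" "B \<subseteq> V" "card B = width" by blast
    with finite_subset[OF _ True] show ?thesis by (intro that[of B]) auto
  next
    case False
    then have "infinite (V - T)" using assms(2) by simp
    then obtain C where C: "finite C" "card C = width - card T" "C \<subseteq> V - T"
      using infinite_arbitrarily_large by blast
    have "card (T \<union> C) = width"
      using C assms by (subst card_Un_disjoint) auto
    with C assms show ?thesis by (intro that[of "T \<union> C"]) auto
  qed
  obtain ys where "set ys = B" "distinct ys" using finite_distinct_list[OF B(1)] by blast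
  with B show ?thesis by (intro bexI[of _ ys]) (auto simp: tuples_def distinct_card)
qed

lemma tuple_subset: "ys \<in> tuples \<Longrightarrow> p \<in> set ys \<Longrightarrow> p \<in> V"
  by (auto simp: tuples_def)

lemma tuple_map:
  assumes "g \<in> auts" "ys \<in> tuples"
  shows "map g ys \<in> tuples"
proof -
  have "inj_on g (set ys)"
    using aut_bij[OF assms(1)] assms(2) inj_on_subset by (auto simp: bij_betw_def tuples_def)
  then show ?thesis using assms(2) aut_closed[OF assms(1)] by (auto simp: tuples_def distinct_map)
qed

section \<open>Forbidden configurations of tuples\<close>

lemma map_eq_self: "map g ys = ys \<longleftrightarrow> (\<forall>p\<in>set ys. g p = p)"
  using map_eq_conv[of g ys "\<lambda>x. x"] by simp

text \<open>A fixed tuple of length four supplies two fixed points, leaving no room for orbits of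
  length two or three in \<open>A\<close>. A shorter tuple exhausts \<open>A\<close>, and
  \<open>g\<close> is the identity there.\<close>

lemma tuple_no_fixed_point:
  assumes g: "g \<in> auts" and ys: "ys \<in> tuples" "map g ys = ys" and zs: "zs \<in> tuples"
    and z: "map g (map g zs) = zs \<or> map g (map g (map g zs)) = zs"
  shows "map g zs = zs"
  unfolding map_eq_self
proof
  fix z assume zin: "z \<in> set zs"
  then have zV: "z \<in> V" using zs tuple_subset by blast
  have fixed: "g p = p" if "p \<in> set ys" for p using ys(2) that by (simp add: map_eq_self)
  have z': "g (g z) = z \<or> g (g (g z)) = z"
    using z zin map_eq_self[of "g \<circ> g" zs] map_eq_self[of "g \<circ> (g \<circ> g)" zs] by auto
  show "g z = z"
  proof (cases "width = 4")
    case False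
    then show ?thesis using tuple_cases[OF ys(1)] zV fixed by blast
  next
    case True
    then have "ys ! 0 \<in> set ys" "ys ! 1 \<in> set ys" "ys ! 0 \<noteq> ys ! 1"
      using ys(1) by (auto simp: tuples_def nth_eq_iff_index_eq)
    then show ?thesis
      using aut_fixing_two[OF g, of "ys ! 0" "ys ! 1" z] aut_fixing_one[OF g, of "ys ! 0" z]
        fixed z' zV tuple_subset[OF ys(1)] by blast
  qed
qed

lemma tuple_no_four_cycle:
  assumes g: "g \<in> auts" and ys: "ys \<in> tuples" "map g (map g (map g (map g ys))) = ys"
  shows "map g (map g ys) = ys"
proof -
  have "g (g p) = p" if "p \<in> set ys" for p
    using ys map_eq_self[of "g \<circ> (g \<circ> (g \<circ> g))" ys] that aut_no_four_cycle[OF g] tuple_subset by auto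
  then show ?thesis using map_eq_self[of "g \<circ> g" ys] by simp
qed

text \<open>At an entry \<open>p\<close> of \<open>a\<close> moved by \<open>g\<close>, either
  \<open>h\<close> or \<open>g \<circ> h\<close> fixes \<open>p\<close>, hence also
  \<open>g p\<close> by commutation. With two fixed points it fixes all of \<open>a\<close>,
  contrary to the distinctness of the tuples.\<close>

lemma tuple_no_klein_four:
  assumes gh: "g \<in> auts" "h \<in> auts" and Y: "{a, b, c, d} \<subseteq> tuples" and d: "distinct [a, b, c, d]"
    and g: "map (map g) [a, b, c, d] = [b, a, d, c]" and h: "map (map h) [a, b, c, d] = [c, d, a, b]"
  shows False
proof -
  have ge: "map g a = b" "map g b = a" "map g c = d" "map g d = c"
    and he: "map h a = c" "map h b = d" "map h c = a" "map h d = b" using g h by auto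
  have V: "p \<in> V" "g p \<in> V" "h p \<in> V" if "p \<in> set a" for p
    using that Y tuple_subset aut_closed gh by auto
  have inv: "g (g p) = p" "h (h p) = p" "g (h p) = h (g p)" if "p \<in> set a" for p
  proof -
    have "map (g \<circ> g) a = a" "map (h \<circ> h) a = a" "map (g \<circ> h) a = map (h \<circ> g) a"
      using ge he by (simp_all flip: map_map)
    then show "g (g p) = p" "h (h p) = p" "g (h p) = h (g p)"
      using that unfolding map_eq_self map_eq_conv by auto
  qed
  have inv': "g (h (g p)) = h p" "h (h (g p)) = g p" if "p \<in> set a" for p
  proof -
    have "map (g \<circ> (h \<circ> g)) a = map h a" "map (h \<circ> (h \<circ> g)) a = map g a"
      using ge he by (simp_all flip: map_map)
    then show "g (h (g p)) = h p" "h (h (g p)) = g p"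
      using that unfolding map_eq_conv by auto
  qed
  obtain p where p: "p \<in> set a" "g p \<noteq> p" using ge(1) d map_eq_self[of g a] by auto
  obtain q where q: "q \<in> set a" "h q \<noteq> q" using he(1) d map_eq_self[of h a] by auto
  obtain r where r: "r \<in> set a" "g r \<noteq> h r" using ge(1) he(1) d map_eq_conv[of g a h] by auto
  consider "h p = p" | "g p = h p" using aut_commuting_involutions[OF gh V(1)[OF p(1)] inv[OF p(1)] inv'[OF p(1)]] p by blast
  then show False
  proof cases
    case 1
    then have "h q = q"
      using aut_fixing_two[OF gh(2) V(1,2)[OF p(1)] V(1)[OF q(1)]] p inv[OF p(1)] inv[OF q(1)] by simp
    with q show False by simp
  next
    case 2
    let ?k = "g \<circ> h"
    have ri: "g (h (g (h r))) = r" using inv[OF r(1)] inv'[OF r(1)] by simp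
    have "?k r = r"
    proof (rule aut_fixing_two[OF aut_comp[OF gh] V(1,2)[OF p(1)] V(1)[OF r(1)]])
      show "p \<noteq> g p" using p by simp
      show "?k p = p" using inv[OF p(1)] by (simp flip: 2)
      show "?k (g p) = g p" using 2 inv'[OF p(1)] by simp
      show "?k (?k r) = r" using ri by simp
    qed
    then have "g r = h r" using inv[OF r(1)] inv'[OF r(1)] by (metis comp_apply)
    with r show False by simp
  qed
qed

text \<open>Each agreement is a fixed point of \<open>g\<close>. Two of them would make
  \<open>g\<close>, an involution on the entries of \<open>a\<close>, fix every entry.\<close>

lemma swapped_tuples_agree_once:
  assumes g: "g \<in> auts" and Y: "a \<in> tuples" "b \<in> tuples" and s: "map g a = b" "map g b = a" "a \<noteq> b"
  shows "card {i. i < width \<and> a ! i = b ! i} \<le> 1"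
proof (rule ccontr)
  assume "\<not> ?thesis"
  then obtain i j where ij: "i \<noteq> j" "i < width" "j < width" "a ! i = b ! i" "a ! j = b ! j"
    by (auto simp: card_le_Suc0_iff_eq)
  have len: "length a = width" "length b = width" "distinct a" using Y by (auto simp: tuples_def)
  have "a ! i \<noteq> a ! j" using ij(1-3) len by (simp add: nth_eq_iff_index_eq)
  moreover have "g (a ! i) = a ! i" "g (a ! j) = a ! j"
    using ij len s(1) by (metis nth_map)+
  moreover have "g (g p) = p" if "p \<in> set a" for p
    using s(1,2) map_eq_self[of "g \<circ> g" a] that by auto
  moreover have "a ! i \<in> V" "a ! j \<in> V" using ij len Y tuple_subset nth_mem by metis+
  ultimately have "g p = p" if "p \<in> set a" for p
    using aut_fixing_two[OF g] that tuple_subset[OF Y(1)] by metis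
  then show False using s map_eq_self[of g a] by simp
qed

lemma tuple_no_swap_triangle:
  assumes fgh: "f \<in> auts" "g \<in> auts" "h \<in> auts" and Y: "{a, b, c} \<subseteq> tuples" and d: "distinct [a, b, c]"
    and s: "map f a = b" "map f b = a" "map g b = c" "map g c = b" "map h a = c" "map h c = a"
  shows False
proof (cases "width = 4")
  case True
  have len: "length a = 4" "length b = 4" "length c = 4" using Y True by (auto simp: tuples_def)
  let ?E = "\<lambda>a b. {i. i < width \<and> a ! i = b ! i}"
  have "i \<in> ?E a b \<union> ?E b c \<union> ?E a c" if i: "i < 4" for i
  proof -
    have "a ! i \<in> V" "b ! i \<in> V" "c ! i \<in> V" using i len Y tuple_subset nth_mem by (metis insert_subset)+
    moreover have "f (a ! i) = b ! i" "f (b ! i) = a ! i" "g (b ! i) = c ! i" "g (c ! i) = b ! i"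
      "h (a ! i) = c ! i" "h (c ! i) = a ! i"
      using s i len by (metis nth_map)+
    ultimately have "a ! i = b ! i \<or> b ! i = c ! i \<or> a ! i = c ! i"
      by (rule aut_no_swap_triangle[OF fgh])
    then show ?thesis using i True by simp
  qed
  then have "{..<4} \<subseteq> ?E a b \<union> ?E b c \<union> ?E a c" by blast
  then have "card {..<4::nat} \<le> card (?E a b \<union> ?E b c \<union> ?E a c)" by (intro card_mono) auto
  also have "\<dots> \<le> card (?E a b) + card (?E b c) + card (?E a c)"
    by (meson add_le_cancel_right card_Un_le order_trans)
  also have "\<dots> \<le> 1 + 1 + 1"
    using swapped_tuples_agree_once[OF fgh(1), of a b] swapped_tuples_agree_once[OF fgh(2), of b c]
      swapped_tuples_agree_once[OF fgh(3), of a c] s d Y by (intro add_mono) auto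
  finally show False by simp
next
  \<comment> \<open>Short tuples exhaust \<open>A\<close>, so one tuple determines an automorphism
    on \<open>A\<close>. Thus \<open>h\<close> agrees there with \<open>g \<circ> f\<close> and
    \<open>f \<circ> g\<close>, and adding \<open>map g a\<close> completes the triangle to a
    forbidden Klein four configuration.\<close>
  case False
  have all: "set t = V" if "t \<in> {a, b, c}" for t using tuple_cases[of t] False Y that by blast
  have ext: "k x = l x" if "map k t = map l t" "t \<in> {a, b, c}" "x \<in> V" for k l :: "'b \<Rightarrow> 'b" and t x
    using that all by (metis map_eq_conv)
  have h1: "h x = g (f x)" and h2: "h x = f (g x)" and f2: "f (f x) = x" and g2: "g (g x) = x" if "x \<in> V" for x
    using ext[of h a "g \<circ> f" x] ext[of h c "f \<circ> g" x] ext[of "f \<circ> f" a "\<lambda>x. x" x]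
      ext[of "g \<circ> g" b "\<lambda>x. x" x] that s by (simp_all flip: map_map)
  define d' where "d' = map g a"
  have d'Y: "d' \<in> tuples"
    using Y tuple_map[OF fgh(2)] by (simp add: d'_def)
  have mc: "map k t = map l t" if "\<And>x. x \<in> V \<Longrightarrow> k x = l x" "t \<in> {a, b, c}" for k l :: "'b \<Rightarrow> 'b" and t
    using that all by (intro map_cong) auto
  have fd: "map f d' = c" using mc[of "f \<circ> g" h a] h2 s by (simp add: d'_def)
  have fc: "map f c = d'"
    using mc[of "f \<circ> h" g a] h2 f2 aut_closed[OF fgh(2)] s by (simp add: d'_def flip: map_map)
  have hb: "map h b = d'"
    using mc[of "h \<circ> f" g a] h1 f2 aut_closed[OF fgh(1)] s by (simp add: d'_def flip: map_map)
  have hd: "map h d' = b"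
    using mc[of "h \<circ> g" f a] h2 g2 aut_closed[OF fgh(2)] s by (simp add: d'_def)
  have "a \<noteq> b" "b \<noteq> c" "a \<noteq> c" using d by simp_all
  then have "d' \<noteq> a" "d' \<noteq> b" "d' \<noteq> c" using fd hd s by metis+
  then show False
    using tuple_no_klein_four[OF fgh(1,3), of a b c d'] Y d'Y d s fd fc hb hd by simp
qed

section \<open>Faithful action of \<open>Aut A\<close> on the limit\<close>

sublocale good_action "map ` auts" tuples
proof
  have "tuples \<subseteq> lists V" by (auto simp: tuples_def)
  then show "countable tuples" using countable_A countable_lists countable_subset by blast
  show "tuples \<noteq> {}" using tuple_containing[of "{}"] by auto
  show "(\<lambda>y. y) \<in> map ` auts" using aut_id by (intro image_eqI[of _ _ "\<lambda>x. x"]) auto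
next
  fix g y assume "g \<in> map ` auts" "y \<in> tuples"
  then show "g y \<in> tuples" using tuple_map by blast
next
  fix g h assume "g \<in> map ` auts" "h \<in> map ` auts"
  then show "g \<circ> h \<in> map ` auts"
    using aut_comp by (auto simp: image_iff intro!: bexI[of _ "_ \<circ> _"])
next
  fix g assume "g \<in> map ` auts"
  then obtain k where k: "k \<in> auts" "g = map k" by blast
  obtain l where l: "l \<in> auts" "\<forall>x\<in>V. l (k x) = x \<and> k (l x) = x" using aut_inverse[OF k(1)] by blast
  have "map l (g y) = y \<and> g (map l y) = y" if "y \<in> tuples" for y
    using l(2) tuple_subset[OF that] by (auto simp: k(2) intro!: map_idI)
  then show "\<exists>h\<in>map ` auts. \<forall>y\<in>tuples. h (g y) = y \<and> g (h y) = y" using l(1) by blast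
next
  fix g y z assume "g \<in> map ` auts" "y \<in> tuples" "g y = y" "z \<in> tuples" "g (g z) = z \<or> g (g (g z)) = z"
  then show "g z = z" using tuple_no_fixed_point by blast
next
  fix g z assume "g \<in> map ` auts" "z \<in> tuples" "g (g (g (g z))) = z"
  then show "g (g z) = z" using tuple_no_four_cycle by blast
next
  fix g h a b c d assume gh: "g \<in> map ` auts" "h \<in> map ` auts"
    and *: "{a, b, c, d} \<subseteq> tuples" "distinct [a, b, c, d]"
      "map g [a, b, c, d] = [b, a, d, c]" "map h [a, b, c, d] = [c, d, a, b]"
  obtain g' where g': "g' \<in> auts" "g = map g'" using gh(1) by blast
  obtain h' where h': "h' \<in> auts" "h = map h'" using gh(2) by blast
  show False
    using tuple_no_klein_four[OF g'(1) h'(1) *(1,2)] *(3,4) unfolding g'(2) h'(2) .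
next
  fix f g h a b c assume fgh: "f \<in> map ` auts" "g \<in> map ` auts" "h \<in> map ` auts"
    and *: "{a, b, c} \<subseteq> tuples" "distinct [a, b, c]"
      "f a = b" "f b = a" "g b = c" "g c = b" "h a = c" "h c = a"
  obtain f' where f': "f' \<in> auts" "f = map f'" using fgh(1) by blast
  obtain g' where g': "g' \<in> auts" "g = map g'" using fgh(2) by blast
  obtain h' where h': "h' \<in> auts" "h = map h'" using fgh(3) by blast
  show False
    using tuple_no_swap_triangle[OF f'(1) g'(1) h'(1) *(1,2)] *(3-8) unfolding f'(2) g'(2) h'(2) .
qed

lemma Aut_limit_monomorphism: "\<exists>h. h \<in> hom (Aut A) (Aut limit) \<and> inj_on h (carrier (Aut A))"
proof (rule Aut_monomorphismI[where \<Phi> = "\<lambda>k. act (map k)"])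
  fix k assume "k \<in> carrier (Aut A)"
  then show "isomorphism limit limit (act (map k))"
    by (intro act_isomorphism) (simp add: Aut_carrier auts_def)
next
  fix k l y assume "k \<in> carrier (Aut A)" "l \<in> carrier (Aut A)" "y \<in> carrier limit"
  then have "set_pt y \<subseteq> tuples" using Omega_pts by (simp add: pts_def)
  then have "act (map (compose V k l)) y = act (map k \<circ> map l) y"
    unfolding map_pt_cong_iff by (auto simp: compose_def tuples_def subset_iff)
  then show "act (map (compose V k l)) y = act (map k) (act (map l) y)" by (simp add: pt.map_comp)
next
  fix k l x assume eq: "\<And>y. y \<in> carrier limit \<Longrightarrow> act (map k) y = act (map l) y" and x: "x \<in> V"
  \<comment> \<open>The point \<open>x\<close> makes \<open>V\<close> nonempty, so some tuple
    contains \<open>x\<close>, and its point without a list detects the value at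
    \<open>x\<close>.\<close>
  then have "1 \<le> width" by (auto simp: width_def Suc_le_eq card_gt_0_iff)
  then obtain ys where ys: "ys \<in> tuples" "x \<in> set ys" using tuple_containing[of "{x}"] x by auto
  have "map k ys = map l ys" using eq[of "Pt ys [] []"] Pt_Nil_Omega[OF ys(1)] by simp
  with ys(2) show "k x = l x" by simp
qed

end

theorem proposition4p10:
  fixes D :: "'a lstr" and A :: "'b lstr"
  assumes "fraisse_limit class_D D"
    and "lstructure A"
    and "embeddable A D"
  shows "\<exists>h. h \<in> hom (Aut A) (Aut D) \<and> inj_on h (carrier (Aut A))"
proof -
  obtain e where e: "embedding A D e" using assms(3) by (auto simp: embeddable_def)
  interpret countable_D_structure A
  proof
    show "D_structure A"
      using assms(2) e fraisse_limit_D_structure[OF assms(1)] by (rule D_structure_embedding)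
    have "countable (e ` carrier A)"
      using e assms(1) countable_subset by (auto simp: embedding_def fraisse_limit_def)
    then show "countable (carrier A)"
      using e countable_image_inj_eq by (auto simp: embedding_def)
  qed
  obtain h where h: "h \<in> hom (Aut A) (Aut limit)" "inj_on h (carrier (Aut A))"
    using Aut_limit_monomorphism by blast
  obtain k where k: "k \<in> hom (Aut limit) (Aut D)" "inj_on k (carrier (Aut limit))"
    using isomorphic_Aut_monomorphism[OF isomorphic_fraisse_limit[OF assms(1)]] by blast
  have "k \<circ> h \<in> hom (Aut A) (Aut D)" using h(1) k(1) by (rule hom_compose)
  moreover have "inj_on (k \<circ> h) (carrier (Aut A))"
    using h k(2) by (intro comp_inj_on) (auto simp: hom_def Pi_iff elim: inj_on_subset)
  ultimately show ?thesis by blast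
qed

end
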